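(* Let $q\ge 2$ be an integer. A real-valued integrable function $\varphi:\mathbb{T}\to\mathbb{R}$ is $q$-hyper-positive if and only if there exists a positive Radon measure $\mu$ on $\mathbb{T}$ such that $\varphi=P_{1/\sqrt q}*\mu$ (equality almost everywhere). Moreover, the positive measure $\mu$ is uniquely determined by $\varphi$.
   Context: $\mathbb{N}=\{0,1,2,\dots\}$, $\mathbb{T}=\mathbb{R}/2\pi\mathbb{Z}$ with normalized Haar measure $m$; for an integrable function $\widehat{\varphi}(n)=\int_{\mathbb{T}}\varphi(e^{i\theta})e^{-in\theta}dm(\theta)$. For $r\in(0,1)$, $P_r(e^{i\theta})=\frac{1}{2\pi}\sum_{n\in\mathbb{Z}}r^{|n|}e^{in\theta}=\frac{1}{2\pi}\frac{1-r^2}{|1-re^{i\theta}|^2}$ and $(P_r*\mu)(e^{i\theta})=\int_{\mathbb{T}}P_r(e^{i(\theta-\theta')})d\mu(\theta')$. Let $\mathbb{F}_q^+$ be the unital free semigroup on generators $s_1,\dots,s_q$, with word length $|\cdot|$. A function $\alpha:\mathbb{N}\to\mathbb{C}$ is $q$-hyper-positive definite ($q$-HPD) if the kernel $K$ on $\mathbb{F}_q^+$ given by $K(\sigma,\delta)=\alpha(|w|)$ if $\delta=\sigma w$ for some $w\in\mathbb{F}_q^+$, $K(\sigma,\delta)=\overline{\alpha(|w|)}$ if $\sigma=\delta w$ for some $w\in\mathbb{F}_q^+$, and $K(\sigma,\delta)=0$ otherwise, is positive definite, i.e. all matrices $[K(\sigma_i,\sigma_j)]_{1\le i,j\le k}$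 with $\sigma_1,\dots,\sigma_k\in\mathbb{F}_q^+$ are non-negative definite. (Equivalently, there is a mean-zero square-integrable process $(X_\sigma)_{\sigma\in\mathbb{F}_q^+}$ with $\mathbb{E}(X_\sigma\overline{X_\delta})=K(\sigma,\delta)$.) An integrable function $\varphi$ on $\mathbb{T}$ is $q$-hyper-positive ($q$-HP) if the function $\mathbb{N}\ni n\mapsto\widehat{\varphi}(n)$ is $q$-HPD. *)

theory Defs
  imports "HOL-Analysis.Analysis" "HOL-Library.Sublist"
begin

text \<open>
  The torus is the unit circle of the complex plane. Functions on it are functions
  on \<^typ>\<open>complex\<close> whose values off the circle are irrelevant.
\<close>

abbreviation torus :: "complex set" where
  "torus \<equiv> sphere 0 1"

definition haar_torus :: "complex measure" where
  "haar_torus = distr (uniform_measure lborel {0..<2 * pi}) (restrict_space borel torus) cis"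

definition fourier_coeff :: "(complex \<Rightarrow> complex) \<Rightarrow> int \<Rightarrow> complex" where
  "fourier_coeff f n = (LINT z|haar_torus. f z * z powi (- n))"

definition poisson_kernel :: "real \<Rightarrow> complex \<Rightarrow> real" where
  "poisson_kernel r z = 1 / (2 * pi) * ((1 - r\<^sup>2) / (cmod (1 - of_real r * z))\<^sup>2)"

lemma poisson_kernel_series:
  fixes z :: complex
  assumes "0 < r" "r < 1" "z \<in> torus"
  shows "((\<lambda>n::int. 1 / (2 * pi) * (of_real r ^ nat \<bar>n\<bar> * z powi n))
           has_sum complex_of_real (poisson_kernel r z)) UNIV"
proof -
  let ?r = "complex_of_real r"
  let ?f = "\<lambda>n::int. ?r ^ nat \<bar>n\<bar> * z powi n"
  have nz: "cmod z = 1" using assms by simp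
  then have z0: "z \<noteq> 0" by auto
  have zc: "z * cnj z = 1" using nz complex_norm_square[of z] by simp
  then have iz: "inverse z = cnj z" by (simp add: inverse_unique)
  have n1: "norm (?r * z) < 1" and n2: "norm (?r * cnj z) < 1"
    using assms nz by (simp_all add: norm_mult)
  have s1: "((\<lambda>n. (?r * z) ^ n) has_sum (1 / (1 - ?r * z))) UNIV"
    by (rule norm_summable_imp_has_sum)
       (use n1 in \<open>auto simp: norm_power summable_geometric intro!: geometric_sums\<close>)
  have s2: "((\<lambda>n. (?r * cnj z) ^ n) has_sum (1 / (1 - ?r * cnj z))) UNIV"
    by (rule norm_summable_imp_has_sum)
       (use n2 in \<open>auto simp: norm_power summable_geometric intro!: geometric_sums\<close>)
  have h1: "(?f has_sum (1 / (1 - ?r * z))) {0..}"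
  proof -
    have "(?f has_sum (1 / (1 - ?r * z))) {0..} \<longleftrightarrow>
        ((\<lambda>n. (?r * z) ^ n) has_sum (1 / (1 - ?r * z))) UNIV"
      by (rule has_sum_reindex_bij_witness[where i = int and j = nat])
         (auto simp: power_mult_distrib power_int_def)
    then show ?thesis using s1 by simp
  qed
  have s2': "((\<lambda>n. (?r * cnj z) * (?r * cnj z) ^ n) has_sum
      ((?r * cnj z) * (1 / (1 - ?r * cnj z)))) UNIV"
    by (rule has_sum_cmult_right[OF s2])
  have h2: "(?f has_sum ((?r * cnj z) * (1 / (1 - ?r * cnj z)))) {..<0}"
  proof -
    have "(?r * cnj z) * (?r * cnj z) ^ nat (- k - 1) = ?f k" if "k < 0" for k
    proof -
      have *: "nat (- k) = Suc (nat (- k - 1))" using that by simp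
      have "?f k = (?r * cnj z) ^ nat (- k)"
        using that by (simp add: power_int_def iz power_mult_distrib)
      then show ?thesis unfolding * by simp
    qed
    then have "(?f has_sum ((?r * cnj z) * (1 / (1 - ?r * cnj z)))) {..<0} \<longleftrightarrow>
        ((\<lambda>n. (?r * cnj z) * (?r * cnj z) ^ n) has_sum
          ((?r * cnj z) * (1 / (1 - ?r * cnj z)))) UNIV"
      by (intro has_sum_reindex_bij_witness
            [where i = "\<lambda>n. - int (Suc n)" and j = "\<lambda>k. nat (- k - 1)"]) auto
    then show ?thesis using s2' by simp
  qed
  have U: "{0..} \<union> {..<0} = (UNIV::int set)" and D: "{0..} \<inter> {..<0} = ({}::int set)" by auto
  have "(?f has_sum (1 / (1 - ?r * z) + (?r * cnj z) * (1 / (1 - ?r * cnj z)))) UNIV"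
    using has_sum_Un_disjoint[OF h1 h2 D] unfolding U .
  moreover have "1 / (1 - ?r * z) + (?r * cnj z) * (1 / (1 - ?r * cnj z))
      = of_real ((1 - r\<^sup>2) / (cmod (1 - ?r * z))\<^sup>2)"
  proof -
    have "1 - ?r * z \<noteq> 0" "1 - ?r * cnj z \<noteq> 0" using n1 n2 by auto
    moreover have "of_real ((cmod (1 - ?r * z))\<^sup>2) = (1 - ?r * z) * (1 - ?r * cnj z)"
      by (subst complex_norm_square) simp
    moreover have "(1 - ?r * cnj z) + ?r * cnj z * (1 - ?r * z) = 1 - ?r\<^sup>2"
      using zc by algebra
    ultimately show ?thesis by (simp add: add_frac_eq)
  qed
  ultimately have "(?f has_sum of_real ((1 - r\<^sup>2) / (cmod (1 - ?r * z))\<^sup>2)) UNIV" by simp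
  from has_sum_cmult_right[OF this, of "1 / (2 * pi)"] show ?thesis
    by (simp add: poisson_kernel_def)
qed

definition radon_measure_on :: "'a::topological_space set \<Rightarrow> 'a measure \<Rightarrow> bool" where
  "radon_measure_on S \<mu> \<longleftrightarrow>
     sets \<mu> = sets (restrict_space borel S) \<and>
     (\<forall>K. compact K \<and> K \<subseteq> S \<longrightarrow> emeasure \<mu> K < \<infinity>) \<and>
     (\<forall>B \<in> sets \<mu>. emeasure \<mu> B = (SUP K \<in> {K. compact K \<and> K \<subseteq> B}. emeasure \<mu> K))"

text \<open>On the unit circle, the difference of two angles becomes a quotient.\<close>

definition poisson_conv :: "real \<Rightarrow> complex measure \<Rightarrow> complex \<Rightarrow> real" where
  "poisson_conv r \<mu> z = (LINT w|\<mu>. poisson_kernel r (z / w))"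

definition nonneg_definite_matrix :: "nat \<Rightarrow> (nat \<Rightarrow> nat \<Rightarrow> complex) \<Rightarrow> bool" where
  "nonneg_definite_matrix k A \<longleftrightarrow>
     (\<forall>c :: nat \<Rightarrow> complex. (\<Sum>i<k. \<Sum>j<k. cnj (c i) * A i j * c j) \<in> \<real>\<^sub>\<ge>\<^sub>0)"

definition positive_definite_kernel :: "'a set \<Rightarrow> ('a \<Rightarrow> 'a \<Rightarrow> complex) \<Rightarrow> bool" where
  "positive_definite_kernel S K \<longleftrightarrow>
     (\<forall>k \<sigma>. (\<forall>i<k. \<sigma> i \<in> S) \<longrightarrow> nonneg_definite_matrix k (\<lambda>i j. K (\<sigma> i) (\<sigma> j)))"

text \<open>
  The free unital semigroup on \<open>q\<close> generators: words over the alphabet \<open>{..<q}\<close>,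
  with concatenation as product and the empty word as unit.
\<close>

definition free_semigroup :: "nat \<Rightarrow> nat list set" where
  "free_semigroup q = lists {..<q}"

text \<open>
  \<open>prefix \<sigma> \<delta>\<close> says \<open>\<delta> = \<sigma> @ w\<close> for some \<open>w\<close>, and then the length of \<open>w\<close> is
  \<open>length \<delta> - length \<sigma>\<close>. If \<open>\<sigma> = \<delta>\<close> the first clause applies; positive
  definiteness forces \<open>\<alpha> 0\<close> to be real, so that the two clauses then agree.
\<close>

definition hpd_kernel :: "(nat \<Rightarrow> complex) \<Rightarrow> nat list \<Rightarrow> nat list \<Rightarrow> complex" where
  "hpd_kernel \<alpha> \<sigma> \<delta> =
     (if prefix \<sigma> \<delta> then \<alpha> (length \<delta> - length \<sigma>)
      else if prefix \<delta> \<sigma> then cnj (\<alpha> (length \<sigma> - length \<delta>))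
      else 0)"

definition hyper_positive_definite :: "nat \<Rightarrow> (nat \<Rightarrow> complex) \<Rightarrow> bool" where
  "hyper_positive_definite q \<alpha> \<longleftrightarrow> positive_definite_kernel (free_semigroup q) (hpd_kernel \<alpha>)"

definition hyper_positive :: "nat \<Rightarrow> (complex \<Rightarrow> complex) \<Rightarrow> bool" where
  "hyper_positive q f \<longleftrightarrow>
     integrable haar_torus f \<and> hyper_positive_definite q (\<lambda>n. fourier_coeff f (int n))"

end

theory Submission
  imports Defs "HOL-Probability.Levy"
begin

text \<open>
  Write \<open>r = 1 / sqrt q\<close> and let \<open>\<mu>\<^sub>k = \<integral> w powi (- k) d\<mu>\<close> be the Fourier coefficients of a measure \<open>\<mu>\<close> on
  the circle. Convolution with the Poisson kernel multiplies them by \<open>r ^ \<bar>k\<bar> / (2 * pi)\<close>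
  (\<open>poisson_conv_fourier\<close>), and Fourier coefficients determine integrable functions up to null sets
  (\<open>AE_eq_if_fourier_coeff_eq\<close>) and finite measures exactly (\<open>torus_measure_eqI\<close>). The last fact gives
  the uniqueness of \<open>\<mu>\<close>. Existence becomes a statement about sequences: \<open>\<alpha>\<close> is \<open>q\<close>-hyper-positive
  definite if and only if \<open>sqrt q ^ n * \<alpha> n\<close> is the sequence of Fourier coefficients of a positive measure.

  If it is such a sequence, it suffices to treat \<open>\<alpha> n = r ^ n * z powi (- n)\<close> with \<open>\<bar>z\<bar> = 1\<close>. The
  kernel is then an explicit Gram matrix: the words of a large length \<open>N\<close> are an orthonormal
  basis, and a word \<open>\<sigma>\<close> is represented by a unimodular multiple of the normalized sum of its
  extensions (\<open>hpd_kernel_eq_level_inner_product\<close>).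

  Conversely, testing a \<open>q\<close>-hyper-positive definite kernel on vectors that depend only on the length
  of the word, with weight \<open>r ^ n\<close> on length \<open>n\<close>, shows that the Toeplitz matrices of
  \<open>sqrt q ^ n * \<alpha> n\<close> are nonnegative definite (\<open>hyper_positive_definite_imp_toeplitz\<close>). Herglotz's
  theorem (\<open>herglotz\<close>) then supplies the measure; it is obtained as a weak limit of Fejer means.
\<close>

section \<open>Finite measures on the circle and their Fourier coefficients\<close>

locale finite_torus_measure = finite_measure M for M :: "complex measure" +
  assumes sets_eq [measurable_cong]: "sets M = sets (restrict_space borel torus)"
begin

lemma space_eq: "space M = torus"
  using sets_eq_imp_space_eq[OF sets_eq] by (simp add: space_restrict_space)

lemma measurable_from_borel:
  "f \<in> borel_measurable borel \<Longrightarrow> f \<in> borel_measurable M"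
  unfolding measurable_cong_sets[OF sets_eq refl] by (rule measurable_restrict_space1)

lemma integrable_bounded:
  fixes f :: "complex \<Rightarrow> 'b::{banach, second_countable_topology}"
  assumes "f \<in> borel_measurable M" "\<And>z. z \<in> torus \<Longrightarrow> norm (f z) \<le> B"
  shows "integrable M f"
  using assms by (intro integrable_const_bound[where B = B]) (auto simp: space_eq)

end

lemma finite_torus_measureI:
  assumes "sets M = sets (restrict_space borel torus)" "emeasure M torus \<noteq> \<infinity>"
  shows "finite_torus_measure M"
proof (intro finite_torus_measure.intro finite_measureI finite_torus_measure_axioms.intro)
  show "emeasure M (space M) \<noteq> \<infinity>"
    using assms sets_eq_imp_space_eq[OF assms(1)] by (simp add: space_restrict_space)
qed fact

lemma measurable_power_int [measurable]:
  "(\<lambda>z::complex. z powi k) \<in> borel_measurable borel"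
  unfolding power_int_def by (cases "k \<ge> 0") simp_all

lemma measurable_power_int' [measurable (raw)]:
  fixes f :: "'a \<Rightarrow> complex"
  shows "f \<in> borel_measurable M \<Longrightarrow> (\<lambda>x. f x powi k) \<in> borel_measurable M"
  by (rule measurable_compose[OF _ measurable_power_int])

lemma norm_powi_torus: "z \<in> torus \<Longrightarrow> cmod (z powi k) = 1"
  by (simp add: norm_power_int)

lemma power_int_minus_torus: "z \<in> torus \<Longrightarrow> z powi (- k) = cnj (z powi k)"
proof -
  assume z: "z \<in> torus"
  have "cnj (z powi k) * z powi k = 1"
    using complex_norm_square[of "z powi k"] norm_powi_torus[OF z, of k] by (simp add: mult.commute)
  then show ?thesis
    by (metis inverse_unique mult.commute power_int_minus)
qed

text \<open>
  On the circle a linear form is a combination of \<open>z\<close> and \<open>1 / z\<close>, so every real polynomial in the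
  coordinates is a trigonometric polynomial there. Rather than expand it, the induction over the
  polynomial shows that multiplication by it preserves the class \<open>G\<close> of functions all of whose
  Fourier coefficients agree under the two measures. Quantifying over \<open>G\<close> makes the case of a
  product a mere composition, and the claim is the case of the constant function in \<open>G\<close>.
\<close>

lemma real_polynomial_integral_eq:
  fixes p :: "complex \<Rightarrow> real"
  assumes "finite_torus_measure M" "finite_torus_measure N"
    and eq: "\<And>k. (LINT z|M. z powi k) = (LINT z|N. z powi k)"
    and p: "real_polynomial_function p"
  shows "(LINT z|M. p z) = (LINT z|N. p z)"
proof -
  interpret M: finite_torus_measure M by fact
  interpret N: finite_torus_measure N by fact
  define G where "G = {g :: complex \<Rightarrow> complex. g \<in> borel_measurable borel \<and>
    (\<exists>B. \<forall>z\<in>torus. cmod (g z) \<le> B) \<and>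
    (\<forall>k. (LINT z|M. g z * z powi k) = (LINT z|N. g z * z powi k))}"
  have int: "integrable M (\<lambda>z. g z * z powi k)" "integrable N (\<lambda>z. g z * z powi k)"
    if "g \<in> G" for g k
  proof -
    from that obtain B where B: "\<forall>z\<in>torus. cmod (g z) \<le> B" and [measurable]: "g \<in> borel_measurable borel"
      by (auto simp: G_def)
    show "integrable M (\<lambda>z. g z * z powi k)"
      using B by (intro M.integrable_bounded[where B = B] M.measurable_from_borel)
        (auto simp: norm_mult norm_power_int)
    show "integrable N (\<lambda>z. g z * z powi k)"
      using B by (intro N.integrable_bounded[where B = B] N.measurable_from_borel)
        (auto simp: norm_mult norm_power_int)
  qed
  have G_add: "(\<lambda>z. f z + g z) \<in> G" if "f \<in> G" "g \<in> G" for f g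
  proof -
    from that obtain B C where "\<forall>z\<in>torus. cmod (f z) \<le> B" "\<forall>z\<in>torus. cmod (g z) \<le> C"
      by (auto simp: G_def)
    then have "\<forall>z\<in>torus. cmod (f z + g z) \<le> B + C"
      by (meson add_mono norm_triangle_ineq order_trans)
    moreover have "(LINT z|M. (f z + g z) * z powi k) = (LINT z|N. (f z + g z) * z powi k)" for k
      using that int[OF that(1), of k] int[OF that(2), of k] by (simp add: distrib_right G_def)
    ultimately show ?thesis using that by (auto simp: G_def)
  qed
  have G_scale: "(\<lambda>z. c * g z) \<in> G" if "g \<in> G" for c g
  proof -
    from that obtain B where "\<forall>z\<in>torus. cmod (g z) \<le> B" by (auto simp: G_def)
    then have "\<forall>z\<in>torus. cmod (c * g z) \<le> cmod c * B"
      by (simp add: norm_mult mult_left_mono)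
    then show ?thesis using that by (auto simp: G_def mult.assoc)
  qed
  have G_shift: "(\<lambda>z. z powi n * g z) \<in> G" if "g \<in> G" for n g
  proof -
    from that obtain B where "\<forall>z\<in>torus. cmod (g z) \<le> B" by (auto simp: G_def)
    then have "\<forall>z\<in>torus. cmod (z powi n * g z) \<le> B"
      by (simp add: norm_mult norm_power_int)
    moreover have "(LINT z|M. z powi n * g z * z powi k) = (LINT z|N. z powi n * g z * z powi k)" for k
    proof -
      have "(LINT z|M. z powi n * g z * z powi k) = (LINT z|M. g z * z powi (n + k))"
        by (rule Bochner_Integration.integral_cong[OF refl], subst power_int_add)
          (auto simp: M.space_eq)
      also have "\<dots> = (LINT z|N. g z * z powi (n + k))" using that by (simp add: G_def)
      also have "\<dots> = (LINT z|N. z powi n * g z * z powi k)"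
        by (rule Bochner_Integration.integral_cong[OF refl], subst power_int_add)
          (auto simp: N.space_eq)
      finally show ?thesis .
    qed
    ultimately show ?thesis using that by (auto simp: G_def)
  qed
  have G_cong: "f \<in> G" if "g \<in> G" "\<And>z. z \<in> torus \<Longrightarrow> f z = g z" "f \<in> borel_measurable borel" for f g
  proof -
    have "(LINT z|M. f z * z powi k) = (LINT z|M. g z * z powi k)"
      "(LINT z|N. f z * z powi k) = (LINT z|N. g z * z powi k)" for k
      using that by (auto intro!: Bochner_Integration.integral_cong simp: M.space_eq N.space_eq)
    then show ?thesis using that by (auto simp: G_def)
  qed
  have "\<forall>g\<in>G. (\<lambda>z. of_real (p z) * g z) \<in> G"
    using p
  proof (induction rule: real_polynomial_function.induct)
    case (linear f)
    interpret bounded_linear f by fact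
    show ?case
    proof
      fix g assume g: "g \<in> G"
      have fz: "f z = Re z * f 1 + Im z * f \<i>" for z
      proof -
        have "f z = f (Re z *\<^sub>R 1 + Im z *\<^sub>R \<i>)"
          by (rule arg_cong[of _ _ f]) (simp add: complex_eq_iff)
        then show ?thesis by (simp only: add scaleR real_scaleR_def)
      qed
      \<comment> \<open>From \<open>Re z = (z + cnj z) / 2\<close>, \<open>Im z = (z - cnj z) / (2 * \<i>)\<close> and \<open>cnj z = 1 / z\<close>.\<close>
      define a b where "a = (f 1 - \<i> * f \<i>) / 2" and "b = (f 1 + \<i> * f \<i>) / 2"
      have "of_real (f z) * g z = a * (z powi 1 * g z) + b * (z powi (-1) * g z)"
        if "z \<in> torus" for z
      proof -
        have "of_real (f z) = a * z + b * cnj z"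
          by (subst fz) (simp add: a_def b_def complex_eq_iff field_simps)
        then show ?thesis
          using power_int_minus_torus[OF that, of 1] by (simp add: algebra_simps)
      qed
      moreover have "f \<in> borel_measurable borel"
        by (intro borel_measurable_continuous_onI linear_continuous_on \<open>bounded_linear f\<close>)
      moreover have "g \<in> borel_measurable borel" using g by (simp add: G_def)
      ultimately show "(\<lambda>z. of_real (f z) * g z) \<in> G"
        by (intro G_cong[OF G_add[OF G_scale[OF G_shift[OF g, of 1]] G_scale[OF G_shift[OF g, of "-1"]]]]) auto
    qed
  next
    case (const c)
    then show ?case by (auto intro: G_scale)
  next
    case (add p q)
    then show ?case by (simp add: distrib_right G_add)
  next
    case (mult p q)
    then show ?case by (simp add: mult.assoc)
  qed
  moreover have "(\<lambda>_. 1) \<in> G" using eq by (auto simp: G_def)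
  ultimately have "(\<lambda>z. of_real (p z)) \<in> G" by fastforce
  then have "\<forall>k. (LINT z|M. complex_of_real (p z) * z powi k) = (LINT z|N. complex_of_real (p z) * z powi k)"
    by (simp add: G_def)
  from spec[OF this, of 0] show ?thesis by simp
qed

text \<open>
  By the Stone--Weierstrass theorem a continuous function is a uniform limit of polynomials on the
  compact circle.
\<close>

lemma continuous_integral_eq:
  fixes f :: "complex \<Rightarrow> real"
  assumes "finite_torus_measure M" "finite_torus_measure N"
    and eq: "\<And>k. (LINT z|M. z powi k) = (LINT z|N. z powi k)"
    and f: "continuous_on UNIV f"
  shows "(LINT z|M. f z) = (LINT z|N. f z)"
proof -
  interpret M: finite_torus_measure M by fact
  interpret N: finite_torus_measure N by fact
  have "continuous_on torus f" using f continuous_on_subset by blast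
  then obtain g where g: "\<And>n. polynomial_function (g n)" and lim: "uniform_limit torus g f sequentially"
    using Stone_Weierstrass_uniform_limit[OF compact_sphere] by metis
  have mg: "g n \<in> borel_measurable borel" for n
    by (intro borel_measurable_continuous_onI continuous_on_polymonial_function g)
  have mf: "f \<in> borel_measurable borel" by (intro borel_measurable_continuous_onI f)
  have "bounded (f ` torus)"
    by (intro compact_imp_bounded compact_continuous_image \<open>continuous_on torus f\<close> compact_sphere)
  then obtain B where B: "\<And>z. z \<in> torus \<Longrightarrow> \<bar>f z\<bar> \<le> B"
    unfolding bounded_iff by (metis image_eqI real_norm_def)
  have "\<forall>\<^sub>F n in sequentially. \<forall>z\<in>torus. dist (g n z) (f z) < 1"
    using uniform_limitD[OF lim, of 1] by simp
  then obtain n0 where n0: "\<And>n z. n \<ge> n0 \<Longrightarrow> z \<in> torus \<Longrightarrow> dist (g n z) (f z) < 1"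
    unfolding eventually_sequentially by blast
  have bd: "\<bar>g (n + n0) z\<bar> \<le> B + 1" if "z \<in> torus" for n z
    using n0[of "n + n0" z] B[of z] that by (auto simp: dist_real_def)
  have pt: "(\<lambda>n. g (n + n0) z) \<longlonglongrightarrow> f z" if "z \<in> torus" for z
    using tendsto_uniform_limitI[OF lim that] by (rule LIMSEQ_ignore_initial_segment)
  have "(\<lambda>n. LINT z|M. g (n + n0) z) \<longlonglongrightarrow> (LINT z|M. f z)"
    using bd pt mf mg
    by (intro integral_dominated_convergence[where w = "\<lambda>_. B + 1"] M.measurable_from_borel)
      (auto simp: M.space_eq)
  moreover have "(\<lambda>n. LINT z|N. g (n + n0) z) \<longlonglongrightarrow> (LINT z|N. f z)"
    using bd pt mf mg
    by (intro integral_dominated_convergence[where w = "\<lambda>_. B + 1"] N.measurable_from_borel)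
      (auto simp: N.space_eq)
  moreover have "(LINT z|M. g n z) = (LINT z|N. g n z)" for n
    using g real_polynomial_integral_eq[OF assms(1,2) eq] by (simp add: real_polynomial_function_eq)
  ultimately show ?thesis using LIMSEQ_unique by simp
qed

text \<open>
  The indicator of a closed set is a bounded pointwise limit of continuous functions, and the closed
  sets form a generator of the Borel sets that is stable under intersection. So the integrals of
  continuous functions, hence the Fourier coefficients, determine a finite measure.
\<close>

lemma torus_measure_eqI:
  assumes "finite_torus_measure M" "finite_torus_measure N"
    and eq: "\<And>k. (LINT z|M. z powi k) = (LINT z|N. z powi k)"
  shows "M = N"
proof -
  interpret M: finite_torus_measure M by fact
  interpret N: finite_torus_measure N by fact
  have closed_eq: "measure M (torus \<inter> C) = measure N (torus \<inter> C)" if C: "closed C" for C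
  proof (cases "C = {}")
    case False
    \<comment> \<open>Continuous functions that equal 1 on \<open>C\<close> and vanish at distance at least \<open>1 / n\<close> from it.\<close>
    define f where "f n z = max 0 (1 - real n * infdist z C)" for n z
    have cont: "continuous_on UNIV (f n)" for n
      unfolding f_def by (intro continuous_intros)
    have mf: "f n \<in> borel_measurable borel" for n
      by (intro borel_measurable_continuous_onI cont)
    have bd: "\<bar>f n z\<bar> \<le> 1" for n z
      by (auto simp: f_def max_def infdist_nonneg)
    have pt: "(\<lambda>n. f n z) \<longlonglongrightarrow> indicator C z" for z
    proof (cases "z \<in> C")
      case True
      then show ?thesis by (simp add: f_def)
    next
      case z: False
      then have pos: "infdist z C > 0"
        using C False by (simp add: infdist_pos_not_in_closed)
      then obtain n0 where "1 < real n0 * infdist z C"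
        using reals_Archimedean3 by blast
      then have "f n z = 0" if "n \<ge> n0" for n
      proof -
        have "real n0 * infdist z C \<le> real n * infdist z C"
          using that pos by (intro mult_right_mono) auto
        with \<open>1 < real n0 * infdist z C\<close> show ?thesis by (simp add: f_def)
      qed
      then have "\<forall>\<^sub>F n in sequentially. f n z = indicator C z"
        using z by (auto simp: eventually_sequentially)
      then show ?thesis by (rule tendsto_eventually)
    qed
    have C': "indicator C \<in> borel_measurable borel" using C by (simp add: borel_closed)
    have "(\<lambda>n. LINT z|M. f n z) \<longlonglongrightarrow> (LINT z|M. indicator C z)"
      using bd pt mf C'
      by (intro integral_dominated_convergence[where w = "\<lambda>_. 1"] M.measurable_from_borel) auto
    moreover have "(\<lambda>n. LINT z|N. f n z) \<longlonglongrightarrow> (LINT z|N. indicator C z)"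
      using bd pt mf C'
      by (intro integral_dominated_convergence[where w = "\<lambda>_. 1"] N.measurable_from_borel) auto
    moreover have "(LINT z|M. f n z) = (LINT z|N. f n z)" for n
      by (rule continuous_integral_eq[OF assms cont])
    ultimately have "(LINT z|M. indicator C z) = (LINT z|N. indicator C z :: real)"
      using LIMSEQ_unique by simp
    then show ?thesis
      using M.measurable_from_borel N.measurable_from_borel C
      by (simp add: M.space_eq N.space_eq Int_commute)
  qed simp
  let ?E = "(\<inter>) torus ` Collect closed"
  have gen: "sets (restrict_space borel torus) = sigma_sets torus ?E"
    by (simp add: sets_restrict_space borel_eq_closed sigma_sets_Int)
  show ?thesis
  proof (rule measure_eqI_generator_eq[where E = ?E and \<Omega> = torus and A = "\<lambda>_. torus"])
    show "Int_stable ?E"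
    proof (rule Int_stableI_image)
      fix C D :: "complex set" assume "C \<in> Collect closed" "D \<in> Collect closed"
      then show "\<exists>E\<in>Collect closed. torus \<inter> C \<inter> (torus \<inter> D) = torus \<inter> E"
        by (intro bexI[of _ "C \<inter> D"]) auto
    qed
  qed (use gen closed_eq in \<open>auto simp: M.sets_eq N.sets_eq M.emeasure_eq_measure N.emeasure_eq_measure
      intro!: image_eqI[of _ _ UNIV]\<close>)
qed

section \<open>Haar measure and Poisson integrals\<close>

lemma measurable_cis_torus: "cis \<in> measurable borel (restrict_space borel torus)"
  by (intro measurable_restrict_space2) (auto intro!: borel_measurable_continuous_onI continuous_intros)

lemma prob_space_uniform_angle: "prob_space (uniform_measure lborel {0..<2 * pi})"
  by (rule prob_space_uniform_measure) auto

lemma prob_space_haar_torus: "prob_space haar_torus"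
  unfolding haar_torus_def
  using measurable_cis_torus by (intro prob_space.prob_space_distr prob_space_uniform_angle) simp

interpretation haar: prob_space haar_torus
  by (rule prob_space_haar_torus)

interpretation haar: finite_torus_measure haar_torus
  by unfold_locales (simp add: haar_torus_def)

lemma haar_torus_integral:
  fixes f :: "complex \<Rightarrow> 'b::{banach, second_countable_topology}"
  assumes "f \<in> borel_measurable borel"
  shows "(LINT z|haar_torus. f z) = (LINT x|uniform_measure lborel {0..<2 * pi}. f (cis x))"
  unfolding haar_torus_def
  using assms measurable_cis_torus
  by (intro integral_distr) (auto intro: measurable_restrict_space1)

lemma haar_torus_power_int: "(LINT z|haar_torus. z powi k) = (if k = 0 then 1 else 0)"
proof (cases "k = 0")
  case True
  then show ?thesis by (simp add: haar.prob_space)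
next
  case False
  have dens: "uniform_measure lborel {0..<2 * pi}
      = density lborel (\<lambda>x. ennreal (indicator {0..<2 * pi} x / (2 * pi)))"
    unfolding uniform_measure_def
    by (intro density_cong) (use divide_ennreal[of 1 "2 * pi"] in \<open>auto simp: indicator_def\<close>)
  have [measurable]: "(\<lambda>x. cis (of_int k * x)) \<in> borel_measurable borel"
    by (intro borel_measurable_continuous_onI continuous_intros)
  define F where "F x = cis (of_int k * x) / (\<i> * of_int k)" for x :: real
  have "(LINT z|haar_torus. z powi k) = (LINT x|uniform_measure lborel {0..<2 * pi}. cis (of_int k * x))"
    by (subst haar_torus_integral) (simp_all add: cis_power_int)
  also have "\<dots> = (LINT x|lborel. (indicator {0..<2 * pi} x / (2 * pi)) *\<^sub>R cis (of_int k * x))"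
    unfolding dens by (intro integral_density) auto
  also have "\<dots> = (LINT x|lborel. (1 / (2 * pi)) *\<^sub>R (indicator {0..2 * pi} x *\<^sub>R cis (of_int k * x)))"
  proof (rule integral_cong_AE)
    show "AE x in lborel. (indicator {0..<2 * pi} x / (2 * pi)) *\<^sub>R cis (of_int k * x)
        = (1 / (2 * pi)) *\<^sub>R (indicator {0..2 * pi} x *\<^sub>R cis (of_int k * x))"
      using AE_lborel_singleton[of "2 * pi"] by eventually_elim (auto simp: indicator_def)
  qed measurable
  also have "\<dots> = (1 / (2 * pi)) *\<^sub>R (F (2 * pi) - F 0)"
  proof -
    have "(LINT x|lborel. indicator {0..2 * pi} x *\<^sub>R cis (of_int k * x)) = F (2 * pi) - F 0"
    proof (rule integral_FTC_Icc)
      fix x :: real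
      have "((\<lambda>u. exp (\<i> * of_int k * u) / (\<i> * of_int k)) has_field_derivative
          exp (\<i> * of_int k * of_real x)) (at (of_real x))"
        using False by (auto intro!: derivative_eq_intros)
      from has_vector_derivative_real_field[OF this]
      show "(F has_vector_derivative cis (of_int k * x)) (at x within {0..2 * pi})"
        unfolding F_def[abs_def] cis_conv_exp by (simp add: mult.assoc)
    qed (auto intro!: continuous_intros)
    then show ?thesis by (simp only: integral_scaleR_right)
  qed
  also have "F (2 * pi) = F 0"
    using cis_multiple_2pi[of "of_int k"] by (simp add: F_def mult_ac)
  finally show ?thesis using False by simp
qed

lemma borel_measurable_poisson_kernel [measurable]:
  "poisson_kernel r \<in> borel_measurable borel"
  unfolding poisson_kernel_def by measurable

lemma poisson_kernel_bounds:
  assumes "0 < r" "r < 1" "z \<in> torus"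
  shows "0 \<le> poisson_kernel r z" "poisson_kernel r z \<le> (1 - r\<^sup>2) / (1 - r)\<^sup>2"
proof -
  have r2: "r\<^sup>2 \<le> 1" using assms by (simp add: power_le_one)
  show "0 \<le> poisson_kernel r z" using r2 by (simp add: poisson_kernel_def)
  have "1 - r \<le> cmod (1 - of_real r * z)"
    using norm_triangle_ineq2[of 1 "of_real r * z"] assms by (simp add: norm_mult)
  then have "(1 - r\<^sup>2) / (cmod (1 - of_real r * z))\<^sup>2 \<le> (1 - r\<^sup>2) / (1 - r)\<^sup>2"
    using assms r2 by (intro divide_left_mono power_mono mult_pos_pos) auto
  moreover have "1 / (2 * pi) \<le> 1" using pi_gt3 by simp
  ultimately have "1 / (2 * pi) * ((1 - r\<^sup>2) / (cmod (1 - of_real r * z))\<^sup>2) \<le> 1 * ((1 - r\<^sup>2) / (1 - r)\<^sup>2)"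
    using r2 by (intro mult_mono) auto
  then show "poisson_kernel r z \<le> (1 - r\<^sup>2) / (1 - r)\<^sup>2"
    by (simp add: poisson_kernel_def)
qed

text \<open>
  Convergence of the symmetric partial sums is the form of the series that dominated convergence
  can integrate term by term.
\<close>

lemma poisson_kernel_partial_sums:
  assumes "0 < r" "r < 1" "z \<in> torus"
  shows "(\<lambda>N. \<Sum>k\<in>{- int N..int N}. of_real (r ^ nat \<bar>k\<bar> / (2 * pi)) * z powi k)
           \<longlonglongrightarrow> complex_of_real (poisson_kernel r z)"
proof -
  have "filterlim (\<lambda>N. {- int N..int N}) (finite_subsets_at_top UNIV) sequentially"
    unfolding filterlim_finite_subsets_at_top
  proof (intro allI impI)
    fix X :: "int set" assume X: "finite X \<and> X \<subseteq> UNIV"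
    then obtain m where m: "\<And>k. k \<in> X \<Longrightarrow> \<bar>k\<bar> \<le> m"
      using finite_abs_int_segment[of 0] bdd_above_finite[of "abs ` X"] by (auto simp: bdd_above_def)
    have "X \<subseteq> {- int N..int N}" if "N \<ge> nat m" for N
    proof
      fix k assume "k \<in> X"
      from m[OF this] that show "k \<in> {- int N..int N}" by auto
    qed
    then show "\<forall>\<^sub>F N in sequentially. finite {- int N..int N} \<and> X \<subseteq> {- int N..int N} \<and> {- int N..int N} \<subseteq> UNIV"
      by (auto simp: eventually_sequentially)
  qed
  from filterlim_compose[OF poisson_kernel_series[OF assms, unfolded has_sum_def] this]
  show ?thesis by (simp add: mult.assoc)
qed

text \<open>
  The Poisson kernel translated by \<open>w\<close> has the Fourier series of the kernel with the \<open>n\<close>-th term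
  multiplied by \<open>w powi (- n)\<close>. Orthogonality of the characters makes the integrals of the partial
  sums eventually constant.
\<close>

lemma poisson_kernel_integral_power_int:
  assumes r: "0 < r" "r < 1" and w: "w \<in> torus"
  shows "(LINT z|haar_torus. of_real (poisson_kernel r (z / w)) * z powi (- n))
           = of_real (r ^ nat \<bar>n\<bar> / (2 * pi)) * w powi (- n)"
proof -
  let ?a = "\<lambda>k::int. complex_of_real (r ^ nat \<bar>k\<bar> / (2 * pi))"
  define S where "S N z = (\<Sum>k\<in>{- int N..int N}. ?a k * z powi k)" for N z
  \<comment> \<open>All coefficients are nonnegative, so on the circle the partial sums are largest at 1, and
      their convergence there gives a dominating constant.\<close>
  have "convergent (\<lambda>N. S N 1)"
    unfolding S_def using poisson_kernel_partial_sums[OF r, of 1] by (auto simp: convergent_def)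
  then obtain B where B: "\<And>N. cmod (S N 1) \<le> B"
    using convergent_imp_Bseq[THEN BseqD] by blast
  have S_le: "cmod (S N z) \<le> B" if "z \<in> torus" for N z
  proof -
    have "cmod (S N z) \<le> (\<Sum>k\<in>{- int N..int N}. r ^ nat \<bar>k\<bar> / (2 * pi))"
      unfolding S_def using r that
      by (intro sum_norm_le) (simp add: norm_mult norm_power_int norm_divide norm_power)
    also have "\<dots> = cmod (S N 1)"
      using r by (simp add: S_def flip: of_real_sum del: of_real_divide of_real_power)
        (simp add: sum_nonneg)
    finally show ?thesis using B[of N] by simp
  qed
  have w0: "w \<noteq> 0" using w by auto
  have tor: "z / w \<in> torus" if "z \<in> torus" for z using that w by (simp add: norm_divide)
  have [measurable]: "S N \<in> borel_measurable borel" for N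
    unfolding S_def by measurable
  have "(\<lambda>N. LINT z|haar_torus. S N (z / w) * z powi (- n))
      \<longlonglongrightarrow> (LINT z|haar_torus. of_real (poisson_kernel r (z / w)) * z powi (- n))"
  proof (rule integral_dominated_convergence[where w = "\<lambda>_. B"])
    show "AE z in haar_torus. (\<lambda>N. S N (z / w) * z powi (- n))
        \<longlonglongrightarrow> of_real (poisson_kernel r (z / w)) * z powi (- n)"
      using poisson_kernel_partial_sums[OF r tor]
      by (auto simp: haar.space_eq S_def intro!: tendsto_intros)
    show "AE z in haar_torus. cmod (S N (z / w) * z powi (- n)) \<le> B" for N
      using S_le[OF tor] by (auto simp: haar.space_eq norm_mult norm_power_int)
    show "(\<lambda>z. of_real (poisson_kernel r (z / w)) * z powi (- n)) \<in> borel_measurable haar_torus"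
      by (rule haar.measurable_from_borel) measurable
    show "(\<lambda>z. S N (z / w) * z powi (- n)) \<in> borel_measurable haar_torus" for N
      by (rule haar.measurable_from_borel) measurable
  qed simp
  moreover have "(LINT z|haar_torus. S N (z / w) * z powi (- n))
      = ?a n * w powi (- n)" if "N \<ge> nat \<bar>n\<bar>" for N
  proof -
    have "(LINT z|haar_torus. S N (z / w) * z powi (- n))
        = (LINT z|haar_torus. (\<Sum>k\<in>{- int N..int N}. ?a k * w powi (- k) * z powi (k - n)))"
    proof (rule Bochner_Integration.integral_cong[OF refl])
      fix z assume "z \<in> space haar_torus"
      then have z0: "z \<noteq> 0" by (auto simp: haar.space_eq)
      have "(z / w) powi k * z powi (- n) = w powi (- k) * z powi (k - n)" for k
        using z0 w0 by (simp add: power_int_divide_distrib power_int_diff power_int_minus field_simps)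
      then show "S N (z / w) * z powi (- n) = (\<Sum>k\<in>{- int N..int N}. ?a k * w powi (- k) * z powi (k - n))"
        by (simp add: S_def sum_distrib_right mult.assoc)
    qed
    also have "\<dots> = (\<Sum>k\<in>{- int N..int N}. ?a k * w powi (- k) * (LINT z|haar_torus. z powi (k - n)))"
    proof -
      have "integrable haar_torus (\<lambda>z. z powi j)" for j
        by (rule haar.integrable_bounded[where B = 1], rule haar.measurable_from_borel)
          (auto simp: norm_power_int)
      then show ?thesis
        by (subst Bochner_Integration.integral_sum) (auto intro: integrable_mult_right)
    qed
    also have "\<dots> = (\<Sum>k\<in>{- int N..int N}. if k = n then ?a n * w powi (- n) else 0)"
      unfolding haar_torus_power_int by (intro sum.cong) auto
    also have "\<dots> = ?a n * w powi (- n)"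
    proof -
      have "n \<in> {- int N..int N}" using that by auto
      then show ?thesis by (simp add: sum.delta)
    qed
    finally show ?thesis .
  qed
  then have "(\<lambda>N. LINT z|haar_torus. S N (z / w) * z powi (- n)) \<longlonglongrightarrow> ?a n * w powi (- n)"
    by (intro tendsto_eventually) (auto simp: eventually_sequentially)
  ultimately show ?thesis by (rule LIMSEQ_unique)
qed

text \<open>
  The integrand is bounded and both measures are finite, so that Fubini's theorem reduces the claim
  to the kernel translated by a single point \<open>w\<close>.
\<close>

lemma poisson_conv_fourier:
  assumes "finite_torus_measure \<mu>" and r: "0 < r" "r < 1"
  shows integrable_poisson_conv: "integrable haar_torus (poisson_conv r \<mu>)"
    and fourier_coeff_poisson_conv: "fourier_coeff (\<lambda>z. of_real (poisson_conv r \<mu> z)) n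
      = of_real (r ^ nat \<bar>n\<bar> / (2 * pi)) * (LINT w|\<mu>. w powi (- n))"
proof -
  interpret \<mu>: finite_torus_measure \<mu> by fact
  interpret P: pair_sigma_finite haar_torus \<mu> ..
  interpret PF: finite_measure "haar_torus \<Otimes>\<^sub>M \<mu>"
    by (rule finite_measure_pair_measure) unfold_locales
  let ?B = "(1 - r\<^sup>2) / (1 - r)\<^sup>2"
  have meas_id [measurable]: "(\<lambda>z. z) \<in> borel_measurable haar_torus" "(\<lambda>z. z) \<in> borel_measurable \<mu>"
    by (auto intro: haar.measurable_from_borel \<mu>.measurable_from_borel)
  have [measurable]: "fst \<in> borel_measurable (haar_torus \<Otimes>\<^sub>M \<mu>)" "snd \<in> borel_measurable (haar_torus \<Otimes>\<^sub>M \<mu>)"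
    using measurable_compose[OF measurable_fst meas_id(1)] measurable_compose[OF measurable_snd meas_id(2)]
    by simp_all
  have tor: "z / w \<in> torus" if "z \<in> torus" "w \<in> torus" for z w
    using that by (simp add: norm_divide)
  have bound: "\<bar>poisson_kernel r (z / w)\<bar> \<le> ?B" if "z \<in> torus" "w \<in> torus" for z w
    using poisson_kernel_bounds[OF r tor[OF that]] by simp
  have "integrable (haar_torus \<Otimes>\<^sub>M \<mu>) (\<lambda>x. poisson_kernel r (fst x / snd x))"
    using bound by (intro PF.integrable_const_bound[where B = ?B])
      (auto simp: space_pair_measure haar.space_eq \<mu>.space_eq)
  from P.integrable_fst'[OF this] show "integrable haar_torus (poisson_conv r \<mu>)"
    by (simp add: poisson_conv_def[abs_def])
  have int: "integrable (haar_torus \<Otimes>\<^sub>M \<mu>)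
      (\<lambda>(z, w). complex_of_real (poisson_kernel r (z / w)) * z powi (- n))"
    using bound by (intro PF.integrable_const_bound[where B = ?B])
      (auto simp: space_pair_measure haar.space_eq \<mu>.space_eq norm_mult norm_power_int split_beta)
  have "fourier_coeff (\<lambda>z. of_real (poisson_conv r \<mu> z)) n
      = (LINT z|haar_torus. LINT w|\<mu>. complex_of_real (poisson_kernel r (z / w)) * z powi (- n))"
    by (simp add: fourier_coeff_def poisson_conv_def)
  also have "\<dots> = (LINT w|\<mu>. LINT z|haar_torus. complex_of_real (poisson_kernel r (z / w)) * z powi (- n))"
    using P.Fubini_integral[OF int] by simp
  also have "\<dots> = (LINT w|\<mu>. of_real (r ^ nat \<bar>n\<bar> / (2 * pi)) * w powi (- n))"
    by (intro Bochner_Integration.integral_cong refl poisson_kernel_integral_power_int r)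
      (simp add: \<mu>.space_eq)
  finally show "fourier_coeff (\<lambda>z. of_real (poisson_conv r \<mu> z)) n
      = of_real (r ^ nat \<bar>n\<bar> / (2 * pi)) * (LINT w|\<mu>. w powi (- n))"
    by simp
qed

text \<open>
  Uniqueness for functions follows from uniqueness for measures, applied to the densities
  given by the positive and the negative part of the difference.
\<close>

lemma AE_eq_if_fourier_coeff_eq:
  fixes f g :: "complex \<Rightarrow> real"
  assumes f: "integrable haar_torus f" and g: "integrable haar_torus g"
    and eq: "\<And>n. fourier_coeff (\<lambda>z. of_real (f z)) n = fourier_coeff (\<lambda>z. of_real (g z)) n"
  shows "AE z in haar_torus. f z = g z"
proof -
  define h where "h z = f z - g z" for z
  have h: "integrable haar_torus h" unfolding h_def using f g by simp
  have hm [measurable]: "h \<in> borel_measurable haar_torus" using h by auto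
  have int: "integrable haar_torus (\<lambda>z. of_real (u z) * z powi k)"
    if "integrable haar_torus u" for u :: "complex \<Rightarrow> real" and k
  proof (rule Bochner_Integration.integrable_bound[OF that])
    show "(\<lambda>z. of_real (u z) * z powi k) \<in> borel_measurable haar_torus"
      using that haar.measurable_from_borel[OF measurable_power_int] by auto
  qed (auto simp: haar.space_eq norm_mult norm_power_int)
  let ?p = "\<lambda>z. max 0 (h z)" and ?m = "\<lambda>z. max 0 (- h z)"
  have pm: "integrable haar_torus ?p" "integrable haar_torus ?m" using h by auto
  have fin: "finite_torus_measure (density haar_torus (\<lambda>z. ennreal (max 0 (u z))))"
    if u: "integrable haar_torus u" for u
  proof -
    have [measurable]: "u \<in> borel_measurable haar_torus" using u by auto
    have "(\<integral>\<^sup>+z. ennreal (max 0 (u z)) \<partial>haar_torus) \<noteq> \<infinity>"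
      using u by (subst nn_integral_eq_integral) auto
    moreover have "emeasure (density haar_torus (\<lambda>z. ennreal (max 0 (u z)))) (space haar_torus)
        = (\<integral>\<^sup>+z. ennreal (max 0 (u z)) \<partial>haar_torus)"
      by (subst emeasure_density) (auto intro!: nn_integral_cong)
    ultimately have "emeasure (density haar_torus (\<lambda>z. ennreal (max 0 (u z)))) torus \<noteq> \<infinity>"
      by (simp add: haar.space_eq)
    then show ?thesis
      by (intro finite_torus_measureI) (simp_all add: haar.sets_eq)
  qed
  have "density haar_torus ?p = density haar_torus ?m"
  proof (rule torus_measure_eqI)
    show "finite_torus_measure (density haar_torus ?p)" using fin[OF h] .
    show "finite_torus_measure (density haar_torus ?m)" using fin[of "\<lambda>z. - h z"] h by simp
    fix k :: int
    have "(LINT z|haar_torus. of_real (f z) * z powi k) = (LINT z|haar_torus. of_real (g z) * z powi k)"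
      using eq[of "- k"] by (simp add: fourier_coeff_def)
    then have 0: "(LINT z|haar_torus. of_real (h z) * z powi k) = 0"
      using int[OF f, of k] int[OF g, of k] by (simp add: h_def left_diff_distrib)
    have "(LINT z|haar_torus. of_real (?p z) * z powi k) - (LINT z|haar_torus. of_real (?m z) * z powi k)
        = (LINT z|haar_torus. of_real (?p z) * z powi k - of_real (?m z) * z powi k)"
      by (rule Bochner_Integration.integral_diff[symmetric]) (intro int pm)+
    also have "\<dots> = (LINT z|haar_torus. of_real (h z) * z powi k)"
      by (rule Bochner_Integration.integral_cong) (auto simp: max_def)
    finally have "(LINT z|haar_torus. of_real (?p z) * z powi k) = (LINT z|haar_torus. of_real (?m z) * z powi k)"
      using 0 by simp
    then show "(LINT z|density haar_torus ?p. z powi k) = (LINT z|density haar_torus ?m. z powi k)"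
      using haar.measurable_from_borel[OF measurable_power_int]
      by (subst (1 2) integral_density) (auto simp: scaleR_conv_of_real)
  qed
  then have "AE z in haar_torus. ennreal (?p z) = ennreal (?m z)"
    by (intro haar.density_unique) auto
  then show ?thesis
    by eventually_elim (auto simp: h_def max_def split: if_splits)
qed

section \<open>The hyper-positive definite kernel on words\<close>

definition words :: "nat \<Rightarrow> nat \<Rightarrow> nat list set" where
  "words q n = {u. set u \<subseteq> {..<q} \<and> length u = n}"

lemma finite_words [simp]: "finite (words q n)"
  unfolding words_def by (rule finite_lists_length_eq) simp

lemma card_words: "card (words q n) = q ^ n"
  unfolding words_def by (subst card_lists_length_eq) simp_all

lemma take_in_words: "v \<in> words q n \<Longrightarrow> m \<le> n \<Longrightarrow> take m v \<in> words q m"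
  by (auto simp: words_def dest: in_set_takeD)

lemma prefix_iff_take: "length u = m \<Longrightarrow> m \<le> length v \<Longrightarrow> prefix u v \<longleftrightarrow> u = take m v"
  by (metis append_eq_conv_conj prefixE take_is_prefix)

lemma free_semigroup_iff: "u \<in> free_semigroup q \<longleftrightarrow> set u \<subseteq> {..<q}"
  by (auto simp: free_semigroup_def)

lemma card_extensions:
  assumes "\<delta> \<in> free_semigroup q" "length \<delta> \<le> N"
  shows "card {u \<in> words q N. prefix \<delta> u} = q ^ (N - length \<delta>)"
proof -
  have "{u \<in> words q N. prefix \<delta> u} = (@) \<delta> ` words q (N - length \<delta>)"
    using assms by (auto simp: words_def prefix_def free_semigroup_iff)
  then show ?thesis
    by (simp add: card_image inj_on_def card_words)
qed

text \<open>
  The Gram representation behind the sufficiency of the Poisson formula. Take the words of length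
  \<open>N\<close> as an orthonormal basis and attach to \<open>\<sigma>\<close> the vector supported on the words that extend \<open>\<sigma>\<close>,
  with the constant entry \<open>r ^ (N - length \<sigma>) * z powi (- length \<sigma>)\<close>. Incomparable words have no
  common extension, hence orthogonal vectors. If \<open>\<delta>\<close> extends \<open>\<sigma>\<close>, the common extensions are those of
  \<open>\<delta>\<close>; there are \<open>q ^ (N - length \<delta>)\<close> of them, and \<open>q * r\<^sup>2 = 1\<close> leaves
  \<open>r ^ (length \<delta> - length \<sigma>)\<close> times a power of \<open>z\<close>. This is where the radius \<open>1 / sqrt q\<close> comes from.
\<close>

lemma hpd_kernel_eq_level_inner_product:
  fixes r :: real
  assumes r: "real q * r\<^sup>2 = 1" and z: "z \<in> torus"
    and "\<sigma> \<in> free_semigroup q" "\<delta> \<in> free_semigroup q" "length \<sigma> \<le> N" "length \<delta> \<le> N"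
  defines "V \<equiv> \<lambda>\<sigma> u. if prefix \<sigma> u then of_real (r ^ (N - length \<sigma>)) * z powi (- int (length \<sigma>)) else 0"
  shows "hpd_kernel (\<lambda>n. of_real (r ^ n) * z powi (- int n)) \<sigma> \<delta>
           = (\<Sum>u\<in>words q N. cnj (V \<sigma> u) * V \<delta> u)"
proof -
  let ?\<beta> = "\<lambda>n. complex_of_real (r ^ n) * z powi (- int n)"
  have z0: "z \<noteq> 0" using z by auto
  have comparable: "(\<Sum>u\<in>words q N. cnj (V \<sigma> u) * V \<delta> u) = ?\<beta> (length \<delta> - length \<sigma>)"
    if "prefix \<sigma> \<delta>" "\<delta> \<in> free_semigroup q" "length \<delta> \<le> N" for \<sigma> \<delta>
  proof -
    define a where "a = length \<sigma>"
    define d where "d = length \<delta> - a"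
    define e where "e = N - length \<delta>"
    have \<delta>: "length \<delta> = a + d" and N: "N - a = e + d" "N - (a + d) = e"
      using prefix_length_le[OF that(1)] that(3) by (auto simp: a_def d_def e_def)
    have "(\<Sum>u\<in>words q N. cnj (V \<sigma> u) * V \<delta> u) = (\<Sum>u\<in>{u \<in> words q N. prefix \<delta> u}.
        cnj (of_real (r ^ (e + d)) * z powi (- int a)) * (of_real (r ^ e) * z powi (- int (a + d))))"
      unfolding V_def using prefix_order.trans[OF that(1)]
      by (intro sum.mono_neutral_cong_right) (auto simp: N \<delta> a_def[symmetric])
    also have "\<dots> = of_real (real q ^ e * r ^ (e + d) * r ^ e) * (cnj (z powi (- int a)) * z powi (- int (a + d)))"
      using card_extensions[OF that(2,3)] by (simp add: e_def[symmetric])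
    also have "real q ^ e * r ^ (e + d) * r ^ e = (real q * r\<^sup>2) ^ e * r ^ d"
      by (simp add: power_add power_mult_distrib power2_eq_square)
    also have "cnj (z powi (- int a)) * z powi (- int (a + d)) = z powi (- int d)"
    proof -
      have "cnj (z powi (- int a)) * z powi (- int (a + d)) = z powi (- (- int a)) * z powi (- int (a + d))"
        by (simp only: power_int_minus_torus[OF z, of "- int a"])
      also have "\<dots> = z powi (- (- int a) + - int (a + d))"
        using z0 by (subst power_int_add) auto
      finally show ?thesis by simp
    qed
    finally show ?thesis using r by (simp add: d_def a_def)
  qed
  consider "prefix \<sigma> \<delta>" | "\<not> prefix \<sigma> \<delta>" "prefix \<delta> \<sigma>" | "\<not> prefix \<sigma> \<delta>" "\<not> prefix \<delta> \<sigma>" by blast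
  then show ?thesis
  proof cases
    case 1
    then show ?thesis using comparable[OF 1] assms(4,6) by (simp add: hpd_kernel_def)
  next
    case 2
    have "hpd_kernel ?\<beta> \<sigma> \<delta> = cnj (?\<beta> (length \<sigma> - length \<delta>))"
      using 2 by (simp add: hpd_kernel_def)
    also have "\<dots> = cnj (\<Sum>u\<in>words q N. cnj (V \<delta> u) * V \<sigma> u)"
      by (simp only: comparable[OF 2(2) \<open>\<sigma> \<in> free_semigroup q\<close> \<open>length \<sigma> \<le> N\<close>])
    also have "\<dots> = (\<Sum>u\<in>words q N. cnj (V \<sigma> u) * V \<delta> u)"
      by (simp add: mult.commute)
    finally show ?thesis .
  next
    case 3
    then have orth: "cnj (V \<sigma> u) * V \<delta> u = 0" for u
      using prefix_same_cases[of \<sigma> u \<delta>] by (auto simp: V_def)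
    show ?thesis using 3 by (simp only: orth sum.neutral_const) (simp add: hpd_kernel_def)
  qed
qed

lemma quadratic_form_gram:
  fixes V :: "'i \<Rightarrow> 'u \<Rightarrow> complex"
  shows "(\<Sum>i\<in>I. \<Sum>j\<in>I. cnj (c i) * (\<Sum>u\<in>U. cnj (V i u) * V j u) * c j)
           = of_real (\<Sum>u\<in>U. (cmod (\<Sum>i\<in>I. c i * V i u))\<^sup>2)"
proof -
  have "(\<Sum>i\<in>I. \<Sum>j\<in>I. cnj (c i) * (\<Sum>u\<in>U. cnj (V i u) * V j u) * c j)
      = (\<Sum>i\<in>I. \<Sum>j\<in>I. \<Sum>u\<in>U. cnj (c i * V i u) * (c j * V j u))"
    by (simp add: sum_distrib_left sum_distrib_right mult_ac)
  also have "\<dots> = (\<Sum>i\<in>I. \<Sum>u\<in>U. \<Sum>j\<in>I. cnj (c i * V i u) * (c j * V j u))"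
    by (intro sum.cong refl sum.swap)
  also have "\<dots> = (\<Sum>u\<in>U. \<Sum>i\<in>I. \<Sum>j\<in>I. cnj (c i * V i u) * (c j * V j u))"
    by (rule sum.swap)
  also have "\<dots> = (\<Sum>u\<in>U. cnj (\<Sum>i\<in>I. c i * V i u) * (\<Sum>j\<in>I. c j * V j u))"
    by (simp add: sum_product)
  also have "\<dots> = of_real (\<Sum>u\<in>U. (cmod (\<Sum>i\<in>I. c i * V i u))\<^sup>2)"
    unfolding of_real_sum complex_norm_square by (simp add: mult.commute)
  finally show ?thesis .
qed

text \<open>
  For a point mass at \<open>z\<close> the kernel is the Gram kernel above; positivity is preserved by
  integration over \<open>z\<close> with respect to a positive measure.
\<close>

lemma hyper_positive_definite_moments:
  fixes r :: real
  assumes "finite_torus_measure \<mu>" and r: "real q * r\<^sup>2 = 1" and "C \<ge> 0"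
  shows "hyper_positive_definite q (\<lambda>n. of_real (C * r ^ n) * (LINT z|\<mu>. z powi (- int n)))"
    (is "hyper_positive_definite q ?\<alpha>")
  unfolding hyper_positive_definite_def positive_definite_kernel_def nonneg_definite_matrix_def
proof (intro allI impI)
  interpret \<mu>: finite_torus_measure \<mu> by fact
  fix k :: nat and \<sigma> :: "nat \<Rightarrow> nat list" and c :: "nat \<Rightarrow> complex"
  assume \<sigma>: "\<forall>i<k. \<sigma> i \<in> free_semigroup q"
  define N where "N = Max (insert 0 ((\<lambda>i. length (\<sigma> i)) ` {..<k}))"
  have len: "length (\<sigma> i) \<le> N" if "i < k" for i
    unfolding N_def using that by (intro Max_ge) auto
  let ?\<beta> = "\<lambda>z n. complex_of_real (r ^ n) * z powi (- int n)"
  have int_pow: "integrable \<mu> (\<lambda>z. z powi j)" for j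
    by (rule \<mu>.integrable_bounded[where B = 1], rule \<mu>.measurable_from_borel)
      (auto simp: norm_power_int)
  have int: "integrable \<mu> (\<lambda>z. hpd_kernel (?\<beta> z) \<sigma> \<delta>)" for \<sigma> \<delta>
  proof -
    have "integrable \<mu> (\<lambda>z. ?\<beta> z n)" for n using int_pow by simp
    moreover from this have "integrable \<mu> (\<lambda>z. cnj (?\<beta> z n))" for n
      unfolding complex_integrable_cnj .
    ultimately show ?thesis
      unfolding hpd_kernel_def by (cases "prefix \<sigma> \<delta>"; cases "prefix \<delta> \<sigma>") (simp_all only: if_True if_False integrable_zero)
  qed
  have kernel: "hpd_kernel ?\<alpha> \<sigma> \<delta> = of_real C * (LINT z|\<mu>. hpd_kernel (?\<beta> z) \<sigma> \<delta>)" for \<sigma> \<delta>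
  proof -
    have moment: "(LINT z|\<mu>. ?\<beta> z n) = of_real (r ^ n) * (LINT z|\<mu>. z powi (- int n))" for n
      by (rule integral_mult_right_zero)
    then have "(LINT z|\<mu>. cnj (?\<beta> z n)) = cnj (of_real (r ^ n) * (LINT z|\<mu>. z powi (- int n)))" for n
      by (simp only: Bochner_Integration.integral_cnj)
    then show ?thesis
      unfolding hpd_kernel_def using moment by (cases "prefix \<sigma> \<delta>"; cases "prefix \<delta> \<sigma>")
        (simp_all only: if_True if_False, simp_all)
  qed
  define Q where "Q z = (\<Sum>u\<in>words q N. (cmod (\<Sum>i<k. c i *
      (if prefix (\<sigma> i) u then of_real (r ^ (N - length (\<sigma> i))) * z powi (- int (length (\<sigma> i))) else 0)))\<^sup>2)" for z
  have "(\<Sum>i<k. \<Sum>j<k. cnj (c i) * hpd_kernel ?\<alpha> (\<sigma> i) (\<sigma> j) * c j)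
      = of_real C * (LINT z|\<mu>. (\<Sum>i<k. \<Sum>j<k. cnj (c i) * hpd_kernel (?\<beta> z) (\<sigma> i) (\<sigma> j) * c j))"
    unfolding kernel using int
    by (simp add: Bochner_Integration.integral_sum sum_distrib_left mult_ac)
  also have "(LINT z|\<mu>. (\<Sum>i<k. \<Sum>j<k. cnj (c i) * hpd_kernel (?\<beta> z) (\<sigma> i) (\<sigma> j) * c j))
      = (LINT z|\<mu>. of_real (Q z))"
  proof (rule Bochner_Integration.integral_cong[OF refl])
    fix z assume "z \<in> space \<mu>"
    then have z: "z \<in> torus" by (simp add: \<mu>.space_eq)
    show "(\<Sum>i<k. \<Sum>j<k. cnj (c i) * hpd_kernel (?\<beta> z) (\<sigma> i) (\<sigma> j) * c j) = of_real (Q z)"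
      unfolding Q_def quadratic_form_gram[symmetric] using \<sigma> len
      by (intro sum.cong refl arg_cong2[where f = "(*)"] hpd_kernel_eq_level_inner_product[OF r z]) auto
  qed
  also have "of_real C * (LINT z|\<mu>. complex_of_real (Q z)) = of_real (C * (LINT z|\<mu>. Q z))"
    by simp
  finally have "(\<Sum>i<k. \<Sum>j<k. cnj (c i) * hpd_kernel ?\<alpha> (\<sigma> i) (\<sigma> j) * c j)
      = of_real (C * (LINT z|\<mu>. Q z))" .
  moreover have "0 \<le> (LINT z|\<mu>. Q z)"
    by (rule Bochner_Integration.integral_nonneg) (simp add: Q_def sum_nonneg)
  ultimately show "(\<Sum>i<k. \<Sum>j<k. cnj (c i) * hpd_kernel ?\<alpha> (\<sigma> i) (\<sigma> j) * c j) \<in> \<real>\<^sub>\<ge>\<^sub>0"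
    using \<open>C \<ge> 0\<close> by (simp only: nonneg_Reals_of_real_iff mult_nonneg_nonneg)
qed

lemma positive_definite_kernel_finite_sum:
  assumes K: "positive_definite_kernel S K" and F: "finite F" "F \<subseteq> S"
  shows "(\<Sum>x\<in>F. \<Sum>y\<in>F. cnj (c x) * K x y * c y) \<in> \<real>\<^sub>\<ge>\<^sub>0"
proof -
  obtain h where h: "bij_betw h {..<card F} F"
    using ex_bij_betw_nat_finite[OF F(1)] by (auto simp: atLeast0LessThan)
  then have "\<forall>i<card F. h i \<in> S" using F(2) by (auto simp: bij_betw_def)
  then have "(\<Sum>i<card F. \<Sum>j<card F. cnj (c (h i)) * K (h i) (h j) * c (h j)) \<in> \<real>\<^sub>\<ge>\<^sub>0"
    using K unfolding positive_definite_kernel_def nonneg_definite_matrix_def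
    by (auto dest!: spec[of _ "\<lambda>i. c (h i)"])
  then show ?thesis
    by (simp add: sum.reindex_bij_betw[OF h, symmetric])
qed

text \<open>
  Each word of the longer length is comparable with exactly one word of the shorter length, so the
  sum counts the words of the longer length.
\<close>

lemma hpd_kernel_level_sum:
  "(\<Sum>u\<in>words q m. \<Sum>v\<in>words q n. hpd_kernel \<alpha> u v)
     = (if m \<le> n then of_nat (q ^ n) * \<alpha> (n - m) else of_nat (q ^ m) * cnj (\<alpha> (m - n)))"
proof (cases "m \<le> n")
  case True
  have "(\<Sum>u\<in>words q m. hpd_kernel \<alpha> u v) = \<alpha> (n - m)" if v: "v \<in> words q n" for v
  proof -
    have "hpd_kernel \<alpha> u v = (if u = take m v then \<alpha> (n - m) else 0)" if u: "u \<in> words q m" for u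
    proof -
      have "length u = m" "length v = n" using u v by (auto simp: words_def)
      moreover have "u = v" if "prefix v u"
        using that calculation True by (auto simp: prefix_def)
      ultimately show ?thesis
        using True prefix_iff_take[of u m v] by (auto simp: hpd_kernel_def)
    qed
    then show ?thesis using take_in_words[OF v True] by (simp add: sum.delta)
  qed
  then show ?thesis using True by (subst sum.swap) (simp add: card_words)
next
  case False
  have "(\<Sum>v\<in>words q n. hpd_kernel \<alpha> u v) = cnj (\<alpha> (m - n))" if u: "u \<in> words q m" for u
  proof -
    have "hpd_kernel \<alpha> u v = (if v = take n u then cnj (\<alpha> (m - n)) else 0)" if v: "v \<in> words q n" for v
    proof -
      have len: "length u = m" "length v = n" using u v by (auto simp: words_def)
      moreover have "\<not> prefix u v" using prefix_length_le[of u v] len False by auto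
      ultimately show ?thesis
        using False prefix_iff_take[of v n u] by (auto simp: hpd_kernel_def)
    qed
    then show ?thesis using take_in_words[OF u, of n] False by (simp add: sum.delta)
  qed
  then show ?thesis using False by (simp add: card_words)
qed

text \<open>
  Testing the kernel on vectors that depend only on the word length, namely \<open>b n / sqrt q ^ n\<close> on the
  words of length \<open>n\<close>, leaves the Toeplitz form of the rescaled sequence \<open>sqrt q ^ n * \<alpha> n\<close>. The
  normalization makes the weight on each level a unit vector times \<open>b n\<close>.
\<close>

lemma hyper_positive_definite_imp_toeplitz:
  assumes hpd: "hyper_positive_definite q \<alpha>" and q: "q > 0"
  defines "T \<equiv> \<lambda>k::int. of_real (sqrt (real q) ^ nat \<bar>k\<bar>) * (if k \<ge> 0 then \<alpha> (nat k) else cnj (\<alpha> (nat (- k))))"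
  shows "(\<Sum>m<N. \<Sum>n<N. cnj (b m) * T (int n - int m) * b n) \<in> \<real>\<^sub>\<ge>\<^sub>0"
proof -
  define s where "s = sqrt (real q)"
  define F where "F = {u \<in> free_semigroup q. length u < N}"
  define c where "c u = b (length u) / of_real (s ^ length u)" for u :: "nat list"
  have s: "s > 0" "s\<^sup>2 = real q" using q by (auto simp: s_def)
  have fin: "finite F"
  proof (rule finite_subset)
    show "F \<subseteq> (\<Union>n<N. words q n)" by (auto simp: F_def words_def free_semigroup_iff)
  qed auto
  have levels: "{u \<in> F. length u = n} = words q n" if "n < N" for n
    using that by (auto simp: F_def words_def free_semigroup_iff)
  have group: "(\<Sum>u\<in>F. g u) = (\<Sum>n<N. \<Sum>u\<in>words q n. g u)" for g :: "nat list \<Rightarrow> complex"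
  proof -
    have "(\<Sum>u\<in>F. g u) = (\<Sum>n<N. \<Sum>u\<in>{u \<in> F. length u = n}. g u)"
      by (rule sum.group[symmetric]) (use fin in \<open>auto simp: F_def\<close>)
    then show ?thesis by (simp add: levels)
  qed
  have "(\<Sum>u\<in>F. \<Sum>v\<in>F. cnj (c u) * hpd_kernel \<alpha> u v * c v) \<in> \<real>\<^sub>\<ge>\<^sub>0"
    using hpd unfolding hyper_positive_definite_def
    by (rule positive_definite_kernel_finite_sum) (use fin in \<open>auto simp: F_def\<close>)
  also have "(\<Sum>u\<in>F. \<Sum>v\<in>F. cnj (c u) * hpd_kernel \<alpha> u v * c v)
      = (\<Sum>m<N. \<Sum>u\<in>words q m. \<Sum>n<N. \<Sum>v\<in>words q n. cnj (c u) * hpd_kernel \<alpha> u v * c v)"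
    by (simp only: group)
  also have "\<dots> = (\<Sum>m<N. \<Sum>n<N. \<Sum>u\<in>words q m. \<Sum>v\<in>words q n. cnj (c u) * hpd_kernel \<alpha> u v * c v)"
    by (intro sum.cong refl sum.swap)
  also have "\<dots> = (\<Sum>m<N. \<Sum>n<N. cnj (b m) * T (int n - int m) * b n)"
  proof (intro sum.cong refl)
    fix m n
    have cancel: "x / of_real (s ^ m) * (y / of_real (s ^ n)) * (of_real (s ^ m * s ^ n * s ^ d) * a)
        = x * (of_real (s ^ d) * a) * y" for x y a :: complex and d
      using s(1) by (simp add: mult_ac)
    have "(\<Sum>u\<in>words q m. \<Sum>v\<in>words q n. cnj (c u) * hpd_kernel \<alpha> u v * c v)
        = (\<Sum>u\<in>words q m. \<Sum>v\<in>words q n.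
            cnj (b m) / of_real (s ^ m) * (b n / of_real (s ^ n)) * hpd_kernel \<alpha> u v)"
      by (intro sum.cong refl) (auto simp: c_def words_def)
    also have "\<dots> = cnj (b m) / of_real (s ^ m) * (b n / of_real (s ^ n))
        * (\<Sum>u\<in>words q m. \<Sum>v\<in>words q n. hpd_kernel \<alpha> u v)"
      by (simp only: sum_distrib_left)
    also have "\<dots> = cnj (b m) * T (int n - int m) * b n"
    proof (cases "m \<le> n")
      case True
      then obtain d where d: "n = m + d" using le_Suc_ex by blast
      have "real q ^ n = s ^ m * s ^ n * s ^ d"
        unfolding s(2)[symmetric] d by (simp add: power_add power_mult_distrib power2_eq_square)
      then have "of_nat (q ^ n) = complex_of_real (s ^ m * s ^ n * s ^ d)"
        by (metis of_nat_power of_real_of_nat_eq)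
      moreover have "T (int n - int m) = of_real (s ^ d) * \<alpha> (n - m)"
        by (simp add: T_def d s_def)
      ultimately show ?thesis
        using True by (simp only: hpd_kernel_level_sum if_True cancel)
    next
      case False
      then obtain d where d: "m = n + d" "d > 0" by (metis less_imp_add_positive not_le)
      have "real q ^ m = s ^ m * s ^ n * s ^ d"
        unfolding s(2)[symmetric] d by (simp add: power_add power_mult_distrib power2_eq_square)
      then have "of_nat (q ^ m) = complex_of_real (s ^ m * s ^ n * s ^ d)"
        by (metis of_nat_power of_real_of_nat_eq)
      moreover have "T (int n - int m) = of_real (s ^ d) * cnj (\<alpha> (m - n))"
        using d(2) by (simp add: T_def d(1) s_def)
      ultimately show ?thesis
        using False by (simp only: hpd_kernel_level_sum if_False cancel)
    qed
    finally show "(\<Sum>u\<in>words q m. \<Sum>v\<in>words q n. cnj (c u) * hpd_kernel \<alpha> u v * c v)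
        = cnj (b m) * T (int n - int m) * b n" .
  qed
  finally show ?thesis .
qed

section \<open>Herglotz's theorem\<close>

text \<open>
  For positive definite \<open>T\<close> this is, on the circle, the Fejer mean
  \<open>\<Sum>\<bar>k\<bar><N. (1 - \<bar>k\<bar> / N) * T k * z powi k\<close> of the formal Fourier series with coefficients \<open>T\<close>. It
  is written as the Toeplitz form at the vector of powers of \<open>z\<close>, which makes its nonnegativity
  immediate.
\<close>

definition fejer :: "(int \<Rightarrow> complex) \<Rightarrow> nat \<Rightarrow> complex \<Rightarrow> real" where
  "fejer T N z = Re (\<Sum>m<N. \<Sum>n<N. cnj (z ^ m) * T (int n - int m) * z ^ n) / real N"

lemma borel_measurable_fejer [measurable]: "fejer T N \<in> borel_measurable borel"
  unfolding fejer_def[abs_def] divide_inverse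
  by (intro borel_measurable_continuous_onI continuous_intros)

text \<open>
  The \<open>k\<close>-th Fourier coefficient collects the pairs \<open>(m, n)\<close> with \<open>n - m = k\<close>, of which there
  are \<open>N - \<bar>k\<bar>\<close>; truncated subtraction gives the correct value 0 for \<open>\<bar>k\<bar> \<ge> N\<close>.
\<close>

lemma fejer_integral:
  assumes psd: "\<And>N b. (\<Sum>m<N. \<Sum>n<N. cnj (b m) * T (int n - int m) * b n) \<in> \<real>\<^sub>\<ge>\<^sub>0"
  shows "(LINT z|haar_torus. of_real (fejer T N z) * z powi (- k))
           = T k * of_real (real (N - nat \<bar>k\<bar>) / real N)"
proof -
  have "(LINT z|haar_torus. of_real (fejer T N z) * z powi (- k))
      = (LINT z|haar_torus. (\<Sum>m<N. \<Sum>n<N. T (int n - int m) / of_nat N * z powi (int n - int m - k)))"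
  proof (rule Bochner_Integration.integral_cong[OF refl])
    fix z assume "z \<in> space haar_torus"
    then have z: "z \<in> torus" and z0: "z \<noteq> 0" by (auto simp: haar.space_eq)
    have "complex_of_real (fejer T N z) = (\<Sum>m<N. \<Sum>n<N. cnj (z ^ m) * T (int n - int m) * z ^ n) / of_nat N"
    proof -
      let ?S = "\<Sum>m<N. \<Sum>n<N. cnj (z ^ m) * T (int n - int m) * z ^ n"
      have "of_real (Re ?S) = ?S"
        by (intro of_real_Re subsetD[OF nonneg_Reals_subset_Reals] psd)
      then show ?thesis by (simp only: fejer_def of_real_divide of_real_of_nat_eq)
    qed
    moreover have "cnj (z ^ m) * T (int n - int m) * z ^ n * z powi (- k)
        = T (int n - int m) * z powi (int n - int m - k)" for m n
    proof -
      have "cnj (z ^ m) = z powi (- int m)"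
        using power_int_minus_torus[OF z, of "int m"] by simp
      moreover have "z powi (int n - int m - k) = z powi (- int m) * z powi int n * z powi (- k)"
      proof -
        have "int n - int m - k = - int m + int n + - k" by simp
        then show ?thesis by (simp only: power_int_add[OF disjI1[OF z0]])
      qed
      ultimately show ?thesis by simp
    qed
    ultimately show "of_real (fejer T N z) * z powi (- k)
        = (\<Sum>m<N. \<Sum>n<N. T (int n - int m) / of_nat N * z powi (int n - int m - k))"
      by (simp only: sum_distrib_right sum_divide_distrib times_divide_eq_left)
  qed
  also have "\<dots> = (\<Sum>m<N. \<Sum>n<N. T (int n - int m) / of_nat N * (LINT z|haar_torus. z powi (int n - int m - k)))"
  proof -
    have "integrable haar_torus (\<lambda>z. z powi j)" for j
      by (rule haar.integrable_bounded[where B = 1], rule haar.measurable_from_borel)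
        (auto simp: norm_power_int)
    then show ?thesis
      by (simp add: Bochner_Integration.integral_sum)
  qed
  also have "\<dots> = (\<Sum>m<N. \<Sum>n<N. if int n = int m + k then T k / of_nat N else 0)"
    unfolding haar_torus_power_int by (intro sum.cong refl) auto
  also have "\<dots> = T k / of_nat N * of_nat (card {m. m < N \<and> (\<exists>n<N. int n = int m + k)})"
  proof -
    have "(\<Sum>n<N. if int n = int m + k then T k / of_nat N else 0)
        = (if \<exists>n<N. int n = int m + k then T k / of_nat N else 0)" for m
    proof (cases "\<exists>n<N. int n = int m + k")
      case True
      then obtain n0 where n0: "n0 < N" "int n0 = int m + k" by blast
      then have "int n = int m + k \<longleftrightarrow> n = n0" for n by auto
      then show ?thesis using True n0(1) by (simp add: sum.delta)
    next
      case False
      then show ?thesis by (auto intro: sum.neutral)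
    qed
    then show ?thesis
      by (simp add: sum.If_cases lessThan_def Collect_conj_eq[symmetric])
  qed
  also have "{m. m < N \<and> (\<exists>n<N. int n = int m + k)}
      = (if k \<ge> 0 then {..<N - nat k} else {nat (- k)..<N})" (is "?A = ?B")
  proof (rule set_eqI)
    fix m
    have "(\<exists>n<N. int n = int m + k) \<longleftrightarrow> 0 \<le> int m + k \<and> int m + k < int N"
      by (auto intro!: exI[of _ "nat (int m + k)"])
    then show "m \<in> ?A \<longleftrightarrow> m \<in> ?B" by auto
  qed
  finally show ?thesis by (auto simp: abs_if)
qed

text \<open>
  Herglotz's theorem. The Fejer means are nonnegative densities with total mass \<open>T 0\<close>, whose Fourier
  coefficients converge to \<open>T\<close>. Lifted to the angle interval \<open>[0, 2 \<pi>)\<close> and normalized they are a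
  tight sequence of probability distributions on the line. Helly's selection theorem yields
  a weak limit, whose characteristic function at the integers is the limit of theirs;
  wrapping this limit around the circle gives the measure.
\<close>

lemma herglotz:
  fixes T :: "int \<Rightarrow> complex"
  assumes psd: "\<And>N b. (\<Sum>m<N. \<Sum>n<N. cnj (b m) * T (int n - int m) * b n) \<in> \<real>\<^sub>\<ge>\<^sub>0"
  obtains \<mu> where "finite_torus_measure \<mu>" "\<And>k. (LINT z|\<mu>. z powi (- k)) = T k"
proof -
  define t where "t = Re (T 0)"
  have "T 0 \<in> \<real>\<^sub>\<ge>\<^sub>0" using psd[where N = 1 and b = "\<lambda>_. 1"] by simp
  then have t: "T 0 = of_real t" "t \<ge> 0" by (auto simp: t_def elim!: nonneg_Reals_cases)
  have fejer_nonneg: "fejer T N z \<ge> 0" for N z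
    unfolding fejer_def using psd[of "\<lambda>n. z ^ n" N]
    by (intro divide_nonneg_nonneg) (simp_all only: complex_nonneg_Reals_iff of_nat_0_le_iff)
  have fejer_integrable: "integrable haar_torus (fejer T N)" for N
  proof -
    have "bounded (fejer T N ` torus)"
      unfolding fejer_def divide_inverse by (intro compact_imp_bounded compact_continuous_image compact_sphere continuous_intros)
    then obtain B where "\<And>z. z \<in> torus \<Longrightarrow> \<bar>fejer T N z\<bar> \<le> B"
      unfolding bounded_iff by (metis image_eqI real_norm_def)
    then show ?thesis
      by (intro haar.integrable_bounded haar.measurable_from_borel) auto
  qed
  have mass: "(LINT z|haar_torus. fejer T (Suc N) z) = t" for N
  proof -
    have "complex_of_real (LINT z|haar_torus. fejer T (Suc N) z) = T 0"
      using fejer_integral[OF psd, of "Suc N" 0] by (simp del: of_nat_Suc)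
    then show ?thesis using t by simp
  qed
  show thesis
  proof (cases "t = 0")
    case True
    \<comment> \<open>Normalization is impossible here, but the densities then vanish almost everywhere, and so does \<open>T\<close>.\<close>
    have "T k = 0" for k
    proof -
      let ?N = "Suc (nat \<bar>k\<bar>)"
      have "cmod (LINT z|haar_torus. of_real (fejer T ?N z) * z powi (- k))
          \<le> (LINT z|haar_torus. fejer T ?N z)"
        using fejer_nonneg
        by (intro order.trans[OF integral_norm_bound] Bochner_Integration.integral_mono_AE' fejer_integrable)
          (auto simp: haar.space_eq norm_mult norm_power_int)
      then show ?thesis
        unfolding mass True fejer_integral[OF psd] by (simp del: of_nat_Suc)
    qed
    moreover have "finite_torus_measure (density haar_torus (\<lambda>_. 0))"
    proof (rule finite_torus_measureI)
      have "torus \<in> sets haar_torus" using sets.top[of haar_torus] by (simp only: haar.space_eq)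
      then show "emeasure (density haar_torus (\<lambda>_. 0)) torus \<noteq> \<infinity>"
        by (subst emeasure_density) simp_all
    qed (simp add: haar.sets_eq)
    moreover have "(LINT z|density haar_torus (\<lambda>_. ennreal 0). z powi (- k)) = 0" for k
      by (subst integral_density) (auto intro: haar.measurable_from_borel)
    ultimately show thesis by (intro that[of "density haar_torus (\<lambda>_. 0)"]) auto
  next
    case False
    then have t_pos: "t > 0" using t by simp
    define U where "U = uniform_measure lborel {0..<2 * pi}"
    have sets_U [measurable_cong]: "sets U = sets borel" by (simp add: U_def)
    have U_integral: "(LINT z|haar_torus. f z) = (LINT x|U. f (cis x))"
      if "f \<in> borel_measurable borel" for f :: "complex \<Rightarrow> complex"
      using haar_torus_integral[OF that] by (simp add: U_def)
    have [measurable]: "cis \<in> borel_measurable borel"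
      by (intro borel_measurable_continuous_onI continuous_intros)
    \<comment> \<open>The index is shifted because the mean of order 0 vanishes identically.\<close>
    define D where "D N = density U (\<lambda>x. ennreal (fejer T (Suc N) (cis x) / t))" for N
    have D_integral: "(LINT x|D N. cis x powi (- k)) = T k / of_real t * of_real (real (Suc N - nat \<bar>k\<bar>) / real (Suc N))"
      for N k
    proof -
      have "(LINT x|D N. cis x powi (- k))
          = (LINT x|U. 1 / of_real t * (of_real (fejer T (Suc N) (cis x)) * cis x powi (- k)))"
        unfolding D_def using fejer_nonneg t_pos
        by (subst integral_density) (auto simp: scaleR_conv_of_real)
      also have "\<dots> = 1 / of_real t * (LINT z|haar_torus. of_real (fejer T (Suc N) z) * z powi (- k))"
        by (subst U_integral) simp_all
      finally show ?thesis
        unfolding fejer_integral[OF psd] by simp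
    qed
    have D_distribution: "real_distribution (D N)" for N
    proof -
      have "emeasure (D N) (space (D N)) = (\<integral>\<^sup>+x. ennreal (fejer T (Suc N) (cis x) / t) \<partial>U)"
        unfolding D_def by (subst emeasure_density) (auto intro!: nn_integral_cong)
      also have "\<dots> = (\<integral>\<^sup>+z. ennreal (fejer T (Suc N) z / t) \<partial>haar_torus)"
        unfolding haar_torus_def U_def using measurable_cis_torus
        by (subst nn_integral_distr) (auto intro: measurable_restrict_space1)
      also have "\<dots> = ennreal (LINT z|haar_torus. fejer T (Suc N) z / t)"
        using fejer_nonneg fejer_integrable t_pos by (intro nn_integral_eq_integral) auto
      also have "\<dots> = 1" using mass t_pos by simp
      finally show ?thesis
        by (intro real_distribution.intro prob_spaceI real_distribution_axioms.intro)
          (simp_all add: D_def sets_U)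
    qed
    have "tight D"
      unfolding tight_def
    proof (intro conjI allI impI D_distribution)
      fix \<epsilon> :: real assume "\<epsilon> > 0"
      \<comment> \<open>The interval is open on the left, so it starts below 0 in order to contain the angle 0.\<close>
      have "measure (D N) {-1<..2 * pi} = 1" for N
      proof -
        interpret D: real_distribution "D N" by (rule D_distribution)
        have "AE x in U. x \<in> {-1<..2 * pi}"
          unfolding U_def by (rule AE_uniform_measureI) auto
        then have "AE x in D N. x \<in> {-1<..2 * pi}"
          unfolding D_def by (subst AE_density) auto
        then show ?thesis by (subst D.prob_eq_1) auto
      qed
      moreover have "-1 < 2 * pi" using pi_gt_zero by linarith
      ultimately show "\<exists>a b. a < b \<and> (\<forall>N. 1 - \<epsilon> < measure (D N) {a<..b})"
        using \<open>\<epsilon> > 0\<close> by (intro exI[of _ "-1"] exI[of _ "2 * pi"]) auto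
    qed
    from tight_imp_convergent_subsubsequence[OF this strict_mono_id]
    obtain s M where s: "strict_mono s" and M: "real_distribution M"
      and conv: "weak_conv_m (\<lambda>n. D (s n)) M"
      by (auto simp: comp_def)
    interpret M: real_distribution M by (rule M)
    have char_int: "char N (- of_int k) = (LINT x|N. cis x powi (- k))" for N k
      by (simp only: char_def cis_power_int) (simp add: cis_conv_exp)
    have M_moment: "(LINT x|M. cis x powi (- k)) = T k / of_real t" for k
    proof (rule LIMSEQ_unique)
      show "(\<lambda>n. LINT x|D (s n). cis x powi (- k)) \<longlonglongrightarrow> (LINT x|M. cis x powi (- k))"
        using levy_continuity1[OF _ M conv] D_distribution by (simp flip: char_int)
      have "(\<lambda>N. T k / of_real t * of_real (real (Suc N - nat \<bar>k\<bar>) / real (Suc N))) \<longlonglongrightarrow> T k / of_real t * of_real 1"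
      proof (intro tendsto_intros)
        have "(\<lambda>N. 1 - real (nat \<bar>k\<bar>) * inverse (real (Suc N))) \<longlonglongrightarrow> 1 - real (nat \<bar>k\<bar>) * 0"
          by (intro tendsto_intros LIMSEQ_inverse_real_of_nat)
        moreover have "\<forall>\<^sub>F N in sequentially. 1 - real (nat \<bar>k\<bar>) * inverse (real (Suc N))
            = real (Suc N - nat \<bar>k\<bar>) / real (Suc N)"
          using eventually_ge_at_top[of "nat \<bar>k\<bar>"]
          by eventually_elim (simp add: of_nat_diff field_simps del: of_nat_Suc)
        ultimately show "(\<lambda>N. real (Suc N - nat \<bar>k\<bar>) / real (Suc N)) \<longlonglongrightarrow> 1"
          by (auto elim: Lim_transform_eventually)
      qed
      then have "(\<lambda>N. LINT x|D N. cis x powi (- k)) \<longlonglongrightarrow> T k / of_real t"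
        unfolding D_integral by simp
      then show "(\<lambda>n. LINT x|D (s n). cis x powi (- k)) \<longlonglongrightarrow> T k / of_real t"
        using LIMSEQ_subseq_LIMSEQ[OF _ s] by (auto simp: comp_def)
    qed
    define \<mu> where "\<mu> = density (distr M (restrict_space borel torus) cis) (\<lambda>_. ennreal t)"
    have cis_M: "cis \<in> measurable M (restrict_space borel torus)"
      using measurable_cis_torus by simp
    have "finite_torus_measure \<mu>"
    proof (rule finite_torus_measureI)
      interpret P: prob_space "distr M (restrict_space borel torus) cis"
        by (rule M.prob_space_distr[OF cis_M])
      have "emeasure \<mu> (space \<mu>) \<noteq> \<infinity>"
        unfolding \<mu>_def space_density
        by (subst emeasure_density_const[OF sets.top]) (simp only: P.emeasure_space_1, simp)
      then show "emeasure \<mu> torus \<noteq> \<infinity>" by (simp add: \<mu>_def space_restrict_space)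
    qed (simp add: \<mu>_def)
    moreover have "(LINT z|\<mu>. z powi (- k)) = T k" for k
    proof -
      have pow: "(\<lambda>z. z powi (- k)) \<in> borel_measurable (restrict_space borel torus)"
        by (intro measurable_restrict_space1) measurable
      have "(LINT z|\<mu>. z powi (- k)) = t *\<^sub>R (LINT z|distr M (restrict_space borel torus) cis. z powi (- k))"
        unfolding \<mu>_def using pow t_pos by (subst integral_density) auto
      also have "\<dots> = t *\<^sub>R (LINT x|M. cis x powi (- k))"
        by (subst integral_distr[OF cis_M pow]) simp
      finally show ?thesis using t_pos by (simp add: M_moment scaleR_conv_of_real)
    qed
    ultimately show thesis by (rule that)
  qed
qed

section \<open>Radon measures and real functions on the circle\<close>

text \<open>
  The circle is compact, and finite Borel measures on a Polish space are inner regular.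
\<close>

lemma radon_measure_on_torus_iff: "radon_measure_on torus \<mu> \<longleftrightarrow> finite_torus_measure \<mu>"
proof
  assume \<mu>: "radon_measure_on torus \<mu>"
  show "finite_torus_measure \<mu>"
  proof (rule finite_torus_measureI)
    show "sets \<mu> = sets (restrict_space borel torus)"
      using \<mu> by (simp add: radon_measure_on_def)
    have "emeasure \<mu> torus < \<infinity>"
      using \<mu> compact_sphere unfolding radon_measure_on_def by blast
    then show "emeasure \<mu> torus \<noteq> \<infinity>" by simp
  qed
next
  assume "finite_torus_measure \<mu>"
  then interpret finite_torus_measure \<mu> .
  define \<nu> where "\<nu> = distr \<mu> borel (\<lambda>z. z)"
  have id: "(\<lambda>z. z) \<in> measurable \<mu> borel" by (rule measurable_from_borel) simp
  have \<nu>: "emeasure \<nu> B = emeasure \<mu> B" if "B \<in> sets borel" "B \<subseteq> torus" for B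
    unfolding \<nu>_def using that by (subst emeasure_distr[OF id]) (auto simp: space_eq Int_absorb2)
  interpret \<nu>: finite_measure \<nu>
    unfolding \<nu>_def by (rule finite_measure_distr[OF id])
  show "radon_measure_on torus \<mu>"
    unfolding radon_measure_on_def
  proof (intro conjI ballI allI impI)
    fix B assume B: "B \<in> sets \<mu>"
    have "torus \<in> sets borel" by (intro borel_closed closed_sphere)
    with B have B': "B \<in> sets borel" "B \<subseteq> torus"
      unfolding sets_eq by (auto simp: sets_restrict_space)
    have "emeasure \<mu> B = emeasure \<nu> B" using \<nu>[OF B'] by simp
    also have "\<dots> = (SUP K\<in>{K. K \<subseteq> B \<and> compact K}. emeasure \<nu> K)"
      using B' by (intro inner_regular) (simp_all add: \<nu>_def \<nu>.emeasure_finite[unfolded \<nu>_def])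
    also have "\<dots> = (SUP K\<in>{K. compact K \<and> K \<subseteq> B}. emeasure \<mu> K)"
      using B' by (intro SUP_cong) (auto intro!: \<nu> borel_compact)
    finally show "emeasure \<mu> B = (SUP K\<in>{K. compact K \<and> K \<subseteq> B}. emeasure \<mu> K)" .
  next
    show "emeasure \<mu> K < \<infinity>" for K
      by (simp add: less_top[symmetric])
  qed (rule sets_eq)
qed

lemma fourier_coeff_eq_moment_if_AE_poisson_conv:
  assumes "finite_torus_measure \<mu>" "0 < r" "r < 1" "integrable haar_torus \<phi>"
    and "AE z in haar_torus. \<phi> z = poisson_conv r \<mu> z"
  shows "fourier_coeff (\<lambda>z. complex_of_real (\<phi> z)) n
           = of_real (r ^ nat \<bar>n\<bar> / (2 * pi)) * (LINT w|\<mu>. w powi (- n))"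
proof -
  note int = integrable_poisson_conv[OF assms(1-3)]
  have [measurable]: "\<phi> \<in> borel_measurable haar_torus" "poisson_conv r \<mu> \<in> borel_measurable haar_torus"
    "(\<lambda>z. z powi (- n)) \<in> borel_measurable haar_torus"
    using assms(4) int by (auto intro: haar.measurable_from_borel)
  have "fourier_coeff (\<lambda>z. complex_of_real (\<phi> z)) n = fourier_coeff (\<lambda>z. of_real (poisson_conv r \<mu> z)) n"
    unfolding fourier_coeff_def
  proof (rule integral_cong_AE)
    show "AE z in haar_torus. complex_of_real (\<phi> z) * z powi (- n) = of_real (poisson_conv r \<mu> z) * z powi (- n)"
      using assms(5) by eventually_elim simp
  qed measurable
  then show ?thesis by (simp only: fourier_coeff_poisson_conv[OF assms(1-3)])
qed

lemma fourier_coeff_uminus_real: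
  "fourier_coeff (\<lambda>z. complex_of_real (\<phi> z)) (- n) = cnj (fourier_coeff (\<lambda>z. complex_of_real (\<phi> z)) n)"
proof -
  have "cnj (fourier_coeff (\<lambda>z. complex_of_real (\<phi> z)) n) = (LINT z|haar_torus. cnj (of_real (\<phi> z) * z powi (- n)))"
    unfolding fourier_coeff_def by (rule Bochner_Integration.integral_cnj[symmetric])
  also have "\<dots> = (LINT z|haar_torus. of_real (\<phi> z) * z powi (- (- n)))"
    by (rule Bochner_Integration.integral_cong[OF refl])
      (simp only: haar.space_eq power_int_minus_torus[of _ "- n"] complex_cnj_mult complex_cnj_complex_of_real)
  finally show ?thesis by (simp only: fourier_coeff_def)
qed

section \<open>Hyper-positive functions are Poisson integrals\<close>

theorem theorem1p9:
  fixes q :: nat and \<phi> :: "complex \<Rightarrow> real"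
  assumes "q \<ge> 2" and "integrable haar_torus \<phi>"
  shows "(hyper_positive q (\<lambda>z. complex_of_real (\<phi> z)) \<longleftrightarrow>
           (\<exists>\<mu>. radon_measure_on torus \<mu> \<and>
                (AE z in haar_torus. \<phi> z = poisson_conv (1 / sqrt (real q)) \<mu> z)))
       \<and> (\<forall>\<mu> \<nu>. radon_measure_on torus \<mu> \<longrightarrow>
                (AE z in haar_torus. \<phi> z = poisson_conv (1 / sqrt (real q)) \<mu> z) \<longrightarrow>
                radon_measure_on torus \<nu> \<longrightarrow>
                (AE z in haar_torus. \<phi> z = poisson_conv (1 / sqrt (real q)) \<nu> z) \<longrightarrow>
                \<mu> = \<nu>)"
proof -
  define r where "r = 1 / sqrt (real q)"
  have r: "0 < r" "r < 1" "real q * r\<^sup>2 = 1" and sqrt_q: "r * sqrt (real q) = 1"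
    using assms(1) by (auto simp: r_def power_divide real_less_rsqrt)
  let ?f = "\<lambda>z. complex_of_real (\<phi> z)"
  let ?a = "\<lambda>n. fourier_coeff ?f n"
  have hyper_positive_if: "hyper_positive q ?f"
    if \<mu>: "finite_torus_measure \<mu>" and AE: "AE z in haar_torus. \<phi> z = poisson_conv r \<mu> z" for \<mu>
  proof -
    have "?a (int n) = of_real (1 / (2 * pi) * r ^ n) * (LINT z|\<mu>. z powi (- int n))" for n
      using fourier_coeff_eq_moment_if_AE_poisson_conv[OF \<mu> r(1,2) assms(2) AE, of "int n"] by simp
    then have "hyper_positive_definite q (\<lambda>n. ?a (int n))"
      using hyper_positive_definite_moments[OF \<mu> r(3), of "1 / (2 * pi)"] by simp
    then show ?thesis using assms(2) by (simp add: hyper_positive_def)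
  qed
  have measure_exists: "\<exists>\<mu>. finite_torus_measure \<mu> \<and> (AE z in haar_torus. \<phi> z = poisson_conv r \<mu> z)"
    if hp: "hyper_positive q ?f"
  proof -
    define T where "T k = of_real (sqrt (real q) ^ nat \<bar>k\<bar>) *
      (if k \<ge> 0 then ?a (int (nat k)) else cnj (?a (int (nat (- k)))))" for k
    have T: "T k = of_real (sqrt (real q) ^ nat \<bar>k\<bar>) * ?a k" for k
      using fourier_coeff_uminus_real[of \<phi> "- k"] by (auto simp: T_def)
    \<comment> \<open>The factor \<open>2 * pi\<close> compensates the factor \<open>1 / (2 * pi)\<close> in the Poisson kernel.\<close>
    have "(\<Sum>m<N. \<Sum>n<N. cnj (b m) * (of_real (2 * pi) * T (int n - int m)) * b n) \<in> \<real>\<^sub>\<ge>\<^sub>0" for N b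
    proof -
      have "(\<Sum>m<N. \<Sum>n<N. cnj (b m) * T (int n - int m) * b n) \<in> \<real>\<^sub>\<ge>\<^sub>0"
        unfolding T_def using hp assms(1)
        by (intro hyper_positive_definite_imp_toeplitz) (auto simp: hyper_positive_def)
      then have "of_real (2 * pi) * (\<Sum>m<N. \<Sum>n<N. cnj (b m) * T (int n - int m) * b n) \<in> \<real>\<^sub>\<ge>\<^sub>0"
        by (intro nonneg_Reals_mult_I) simp_all
      then show ?thesis by (simp only: sum_distrib_left mult_ac)
    qed
    then obtain \<mu> where \<mu>: "finite_torus_measure \<mu>"
      and moment: "\<And>k. (LINT z|\<mu>. z powi (- k)) = of_real (2 * pi) * T k"
      using herglotz[of "\<lambda>k. of_real (2 * pi) * T k"] by blast
    have "fourier_coeff (\<lambda>z. of_real (poisson_conv r \<mu> z)) n = ?a n" for n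
    proof -
      have "fourier_coeff (\<lambda>z. of_real (poisson_conv r \<mu> z)) n
          = of_real ((r * sqrt (real q)) ^ nat \<bar>n\<bar>) * ?a n"
        unfolding fourier_coeff_poisson_conv[OF \<mu> r(1,2)] moment T by (simp add: power_mult_distrib)
      then show ?thesis by (simp add: sqrt_q)
    qed
    then have "AE z in haar_torus. \<phi> z = poisson_conv r \<mu> z"
      by (intro AE_eq_if_fourier_coeff_eq assms(2) integrable_poisson_conv[OF \<mu> r(1,2)]) simp
    with \<mu> show ?thesis by blast
  qed
  have unique: "\<mu> = \<nu>"
    if \<mu>: "finite_torus_measure \<mu>" "AE z in haar_torus. \<phi> z = poisson_conv r \<mu> z"
      and \<nu>: "finite_torus_measure \<nu>" "AE z in haar_torus. \<phi> z = poisson_conv r \<nu> z" for \<mu> \<nu>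
  proof (rule torus_measure_eqI[OF \<mu>(1) \<nu>(1)])
    fix k
    have "of_real (r ^ nat \<bar>- k\<bar> / (2 * pi)) * (LINT z|\<mu>. z powi (- (- k)))
        = of_real (r ^ nat \<bar>- k\<bar> / (2 * pi)) * (LINT z|\<nu>. z powi (- (- k)))"
      using fourier_coeff_eq_moment_if_AE_poisson_conv[OF \<mu>(1) r(1,2) assms(2) \<mu>(2), of "- k"]
        fourier_coeff_eq_moment_if_AE_poisson_conv[OF \<nu>(1) r(1,2) assms(2) \<nu>(2), of "- k"]
      by (simp only:)
    then show "(LINT z|\<mu>. z powi k) = (LINT z|\<nu>. z powi k)" using r(1) by simp
  qed
  show ?thesis
    unfolding r_def[symmetric] radon_measure_on_torus_iff
    using hyper_positive_if measure_exists unique by blast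
qed

end
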